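(* Let $I\subset R=K[x_1,\ldots,x_n]$ be a normally torsion-free square-free monomial ideal, let $\mathfrak{q}$ be a prime monomial ideal in $R$, and let $h$ be a square-free monomial in $R$ with $\mathrm{supp}(h)\cap(\mathrm{supp}(\mathfrak{q})\cup\mathrm{supp}(I))=\emptyset$. Suppose that $\bigcap_{\mathfrak{p}\in\mathrm{Ass}(I)}\mathfrak{p}\cap\bigcap_{x_r\in\mathrm{supp}(h)}(\mathfrak{q},x_r)$ is a minimal primary decomposition of $I\cap(\mathfrak{q},h)$, and that $\bigcap_{\mathfrak{p}\in\mathrm{Ass}(I)}\mathfrak{p}\cap\mathfrak{q}$ is a minimal primary decomposition of $I\cap\mathfrak{q}$. Suppose that $I$ and $I\cap\mathfrak{q}$ are normally torsion-free. Then $L:=I\cap(\mathfrak{q},h)$ is normally torsion-free.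
   Context: $R=K[x_1,\ldots,x_n]$ is a polynomial ring over a field $K$. For an ideal $I\subset R$, $\mathrm{Ass}(I)=\mathrm{Ass}_R(R/I)$ denotes the set of associated primes of $R/I$. An ideal $I$ is normally torsion-free if $\mathrm{Ass}_R(R/I^k)\subseteq\mathrm{Ass}_R(R/I)$ for all $k\ge 1$. The support $\mathrm{supp}(u)$ of a monomial $u$ is the set of variables dividing $u$; for a monomial ideal $J$ with minimal monomial generating set $\mathcal{G}(J)$, $\mathrm{supp}(J)=\bigcup_{u\in\mathcal{G}(J)}\mathrm{supp}(u)$. A prime monomial ideal is a prime ideal generated by a set of variables. $(\mathfrak{q},h)$ denotes the ideal $\mathfrak{q}+hR$, and $(\mathfrak{q},x_r)=\mathfrak{q}+x_rR$. A primary decomposition is minimal if the listed components have pairwise distinct radicals and none of them can be omitted. *)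

theory Defs
  imports
    "HOL-Library.Poly_Mapping"
    "HOL-Algebra.Algebraic_Closure_Type"
    "HOL-Algebra.Ideal_Product"
    "HOL-Algebra.QuotRing"
begin

section \<open>Associated primes, normal torsion-freeness, primary decomposition\<close>

text \<open>
  A prime \<open>P\<close> is associated to the \<open>R\<close>-module \<open>R/I\<close> if it is the annihilator of some
  \<open>x \<in> R/I\<close>; a scalar \<open>r\<close> acts on \<open>R/I\<close> as multiplication by its residue class.
\<close>

definition Ass :: "('r, 'b) ring_scheme \<Rightarrow> 'r set \<Rightarrow> 'r set set" where
  "Ass R I = {P. primeideal P R \<and>
     (\<exists>x\<in>carrier (R Quot I).
        P = {r \<in> carrier R. (I +>\<^bsub>R\<^esub> r) \<otimes>\<^bsub>R Quot I\<^esub> x = \<zero>\<^bsub>R Quot I\<^esub>})}"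

definition normally_torsion_free :: "('r, 'b) ring_scheme \<Rightarrow> 'r set \<Rightarrow> bool" where
  "normally_torsion_free R I \<longleftrightarrow>
     ideal I R \<and> (\<forall>k::nat. k \<ge> 1 \<longrightarrow> Ass R (I [^]\<^bsub>ideals_set R\<^esub> k) \<subseteq> Ass R I)"

definition radical :: "('r, 'b) ring_scheme \<Rightarrow> 'r set \<Rightarrow> 'r set" where
  "radical R J = {a \<in> carrier R. \<exists>m::nat. a [^]\<^bsub>R\<^esub> m \<in> J}"

definition primary_ideal :: "('r, 'b) ring_scheme \<Rightarrow> 'r set \<Rightarrow> bool" where
  "primary_ideal R Q \<longleftrightarrow> ideal Q R \<and> Q \<noteq> carrier R \<and>
     (\<forall>a\<in>carrier R. \<forall>b\<in>carrier R. a \<otimes>\<^bsub>R\<^esub> b \<in> Q \<longrightarrow> a \<in> Q \<or> b \<in> radical R Q)"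

text \<open>
  Decompositions are indexed families, so that the same ideal listed under two indices
  counts as a repetition. The empty intersection is the whole ring.
\<close>

definition minimal_primary_decomposition ::
    "('r, 'b) ring_scheme \<Rightarrow> 'i set \<Rightarrow> ('i \<Rightarrow> 'r set) \<Rightarrow> 'r set \<Rightarrow> bool" where
  "minimal_primary_decomposition R A Q J \<longleftrightarrow>
     finite A \<and> (\<forall>i\<in>A. primary_ideal R (Q i)) \<and>
     J = carrier R \<inter> (\<Inter>i\<in>A. Q i) \<and>
     inj_on (\<lambda>i. radical R (Q i)) A \<and>
     (\<forall>j\<in>A. carrier R \<inter> (\<Inter>i\<in>A - {j}. Q i) \<noteq> J)"


section \<open>Monomial ideals in polynomial rings\<close>

text \<open>
  \<open>K[x\<^sub>1,\<dots>,x\<^sub>n]\<close> is the monoid algebra of the exponent vectors: the variables are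
  indexed by a type \<open>'n\<close>, of cardinality \<open>n\<close> once it is constrained to be finite.
\<close>

type_synonym ('n, 'a) mpoly = "('n \<Rightarrow>\<^sub>0 nat) \<Rightarrow>\<^sub>0 'a"

abbreviation mpoly_ring :: "('n, 'a::field) mpoly ring" where
  "mpoly_ring \<equiv> ring_of_type_algebra"

definition Var :: "'n \<Rightarrow> ('n, 'a::field) mpoly" where
  "Var i = Poly_Mapping.single (Poly_Mapping.single i 1) 1"

definition monomials :: "('n, 'a::field) mpoly set" where
  "monomials = range (\<lambda>t. Poly_Mapping.single t 1)"

definition squarefree_monomials :: "('n, 'a::field) mpoly set" where
  "squarefree_monomials = {u \<in> monomials. \<forall>i. \<not> Var i ^ 2 dvd u}"

definition supp :: "('n, 'a::field) mpoly \<Rightarrow> 'n set" where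
  "supp u = {i. Var i dvd u}"

definition squarefree_monomial_ideal :: "('n, 'a::field) mpoly set \<Rightarrow> bool" where
  "squarefree_monomial_ideal I \<longleftrightarrow> (\<exists>G \<subseteq> squarefree_monomials. I = Idl\<^bsub>mpoly_ring\<^esub> G)"

text \<open>
  Meaningful for monomial ideals in finitely many variables, which have exactly one such
  generating set; see \<open>minimal_generators_eq\<close>.
\<close>

definition minimal_generators :: "('n, 'a::field) mpoly set \<Rightarrow> ('n, 'a) mpoly set" where
  "minimal_generators J = (THE G. G \<subseteq> monomials \<and> Idl\<^bsub>mpoly_ring\<^esub> G = J \<and>
     (\<forall>G'. G' \<subset> G \<longrightarrow> Idl\<^bsub>mpoly_ring\<^esub> G' \<noteq> J))"

definition ideal_supp :: "('n, 'a::field) mpoly set \<Rightarrow> 'n set" where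
  "ideal_supp J = (\<Union>u\<in>minimal_generators J. supp u)"

definition prime_monomial_ideal :: "('n, 'a::field) mpoly set \<Rightarrow> bool" where
  "prime_monomial_ideal q \<longleftrightarrow>
     primeideal q mpoly_ring \<and> (\<exists>S. q = Idl\<^bsub>mpoly_ring\<^esub> (Var ` S))"


section \<open>Basic facts\<close>

lemma Ass_iff_colon:
  assumes "cring R" "ideal I R"
  shows "P \<in> Ass R I \<longleftrightarrow>
    primeideal P R \<and> (\<exists>f\<in>carrier R. P = {r \<in> carrier R. r \<otimes>\<^bsub>R\<^esub> f \<in> I})"
proof -
  interpret I: ideal I R by fact
  have carr: "carrier (R Quot I) = (\<lambda>f. I +>\<^bsub>R\<^esub> f) ` carrier R"
    by (auto simp: FactRing_def A_RCOSETS_def')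
  have zero: "(I +>\<^bsub>R\<^esub> r) \<otimes>\<^bsub>R Quot I\<^esub> (I +>\<^bsub>R\<^esub> f) = \<zero>\<^bsub>R Quot I\<^esub>
      \<longleftrightarrow> r \<otimes>\<^bsub>R\<^esub> f \<in> I" if "r \<in> carrier R" "f \<in> carrier R" for r f
  proof -
    have "(I +>\<^bsub>R\<^esub> r) \<otimes>\<^bsub>R Quot I\<^esub> (I +>\<^bsub>R\<^esub> f) = I +>\<^bsub>R\<^esub> (r \<otimes>\<^bsub>R\<^esub> f)"
      using I.rcoset_mult_add[OF that] by (simp add: FactRing_def)
    moreover have "\<zero>\<^bsub>R Quot I\<^esub> = I"
      by (simp add: FactRing_def)
    moreover have "I +>\<^bsub>R\<^esub> (r \<otimes>\<^bsub>R\<^esub> f) = I \<longleftrightarrow> r \<otimes>\<^bsub>R\<^esub> f \<in> I"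
      using that I.m_closed I.a_rcos_const I.a_rcos_self by metis
    ultimately show ?thesis by simp
  qed
  have "{r \<in> carrier R. (I +>\<^bsub>R\<^esub> r) \<otimes>\<^bsub>R Quot I\<^esub> (I +>\<^bsub>R\<^esub> f) = \<zero>\<^bsub>R Quot I\<^esub>}
      = {r \<in> carrier R. r \<otimes>\<^bsub>R\<^esub> f \<in> I}" if "f \<in> carrier R" for f
    using zero that by auto
  then show ?thesis
    unfolding Ass_def carr by auto
qed

lemma mpoly_ring_simps [simp]:
  "carrier mpoly_ring = UNIV" "x \<otimes>\<^bsub>mpoly_ring\<^esub> y = x * y" "x \<oplus>\<^bsub>mpoly_ring\<^esub> y = x + y"
  "\<zero>\<^bsub>mpoly_ring\<^esub> = 0" "\<one>\<^bsub>mpoly_ring\<^esub> = 1"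
  by (simp_all add: ring_of_type_algebra_def)

lemma cring_mpoly_ring: "cring (mpoly_ring :: ('n, 'a::field) mpoly ring)"
  by (rule cring_from_type_algebra)

lemma monomial_dvd_iff:
  "Poly_Mapping.single s 1 dvd (Poly_Mapping.single t 1 :: ('n, 'a::field) mpoly)
     \<longleftrightarrow> (\<exists>r. t = s + r)"
proof
  assume "Poly_Mapping.single s 1 dvd (Poly_Mapping.single t 1 :: ('n, 'a) mpoly)"
  then obtain k :: "('n, 'a) mpoly"
    where k: "Poly_Mapping.single t 1 = Poly_Mapping.single s 1 * k"
    by (auto simp: dvd_def)
  have "t \<in> Poly_Mapping.keys (Poly_Mapping.single t 1 :: ('n, 'a) mpoly)" by simp
  also have "\<dots> \<subseteq> {a + b | a b. a \<in> Poly_Mapping.keys (Poly_Mapping.single s 1 :: ('n, 'a) mpoly) \<and> b \<in> Poly_Mapping.keys k}"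
    unfolding k by (rule keys_mult)
  finally show "\<exists>r. t = s + r" by auto
next
  assume "\<exists>r. t = s + r"
  then obtain r where "t = s + r" ..
  then have "(Poly_Mapping.single t 1 :: ('n, 'a) mpoly)
      = Poly_Mapping.single s 1 * Poly_Mapping.single r 1"
    by (simp add: mult_single)
  then show "Poly_Mapping.single s 1 dvd (Poly_Mapping.single t 1 :: ('n, 'a) mpoly)"
    by (metis dvd_triv_left)
qed

lemma supp_monomial:
  "supp (Poly_Mapping.single t 1 :: ('n, 'a::field) mpoly) = Poly_Mapping.keys t"
proof -
  have "(\<exists>r. t = Poly_Mapping.single i 1 + r) \<longleftrightarrow> Poly_Mapping.lookup t i \<noteq> 0" for i
  proof
    assume "Poly_Mapping.lookup t i \<noteq> 0"
    then have "t = Poly_Mapping.single i 1 + (t - Poly_Mapping.single i 1)"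
      by (intro poly_mapping_eqI) (auto simp: lookup_add lookup_minus lookup_single when_def Suc_le_eq)
    then show "\<exists>r. t = Poly_Mapping.single i 1 + r" ..
  qed (auto simp: lookup_add)
  then show ?thesis
    by (auto simp: supp_def Var_def monomial_dvd_iff in_keys_iff)
qed

lemma squarefree_monomials_iff:
  "(Poly_Mapping.single t 1 :: ('n, 'a::field) mpoly) \<in> squarefree_monomials
     \<longleftrightarrow> (\<forall>i. Poly_Mapping.lookup t i \<le> 1)"
proof -
  have eq: "(\<exists>r. t = Poly_Mapping.single i 2 + r) \<longleftrightarrow> Poly_Mapping.lookup t i > 1" for i
  proof
    assume "Poly_Mapping.lookup t i > 1"
    then have "t = Poly_Mapping.single i 2 + (t - Poly_Mapping.single i 2)"
      by (intro poly_mapping_eqI) (auto simp: lookup_add lookup_minus lookup_single when_def Suc_le_eq)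
    then show "\<exists>r. t = Poly_Mapping.single i 2 + r" ..
  qed (auto simp: lookup_add)
  have "Var i ^ 2 = (Poly_Mapping.single (Poly_Mapping.single i 2) 1 :: ('n, 'a) mpoly)" for i
    by (simp add: Var_def power2_eq_square mult_single numeral_2_eq_2 flip: single_add)
  then show ?thesis
    by (auto simp: squarefree_monomials_def monomials_def monomial_dvd_iff eq not_less)
qed

lemma monomial_in_genideal:
  fixes G :: "('n, 'a::field) mpoly set"
  assumes G: "G \<subseteq> monomials" and u: "u \<in> monomials" "u \<in> Idl\<^bsub>mpoly_ring\<^esub> G"
  shows "\<exists>g\<in>G. g dvd u"
proof -
  interpret cring "mpoly_ring :: ('n, 'a) mpoly ring" by (rule cring_mpoly_ring)
  define M :: "('n, 'a) mpoly set"
    where "M = {p. \<forall>t\<in>Poly_Mapping.keys p. \<exists>s r. Poly_Mapping.single s 1 \<in> G \<and> t = s + r}"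
  have mult: "x * a \<in> M" if "a \<in> M" for a x
  proof -
    have "\<exists>s r. Poly_Mapping.single s 1 \<in> G \<and> t = s + r" if t: "t \<in> Poly_Mapping.keys (x * a)" for t
    proof -
      from t keys_mult[of x a] obtain y b where yb: "t = y + b" "b \<in> Poly_Mapping.keys a" by blast
      with \<open>a \<in> M\<close> obtain s r where sr: "Poly_Mapping.single s 1 \<in> G" "b = s + r"
        by (auto simp: M_def)
      then have "t = s + (y + r)" by (simp add: yb add_ac)
      with sr show ?thesis by blast
    qed
    then show ?thesis by (auto simp: M_def)
  qed
  have "ideal M mpoly_ring"
  proof (rule idealI)
    show "subgroup M (add_monoid (mpoly_ring :: ('n, 'a) mpoly ring))"
    proof (rule add.subgroupI)
      have "0 \<in> M" by (simp add: M_def)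
      then show "M \<noteq> {}" by blast
    next
      fix a assume a: "a \<in> M"
      have "\<ominus>\<^bsub>mpoly_ring\<^esub> a = - a"
        using r_neg[of a] by (simp add: add_eq_0_iff)
      then show "\<ominus>\<^bsub>mpoly_ring\<^esub> a \<in> M" using mult[OF a, of "-1"] by simp
    next
      fix a b assume "a \<in> M" "b \<in> M"
      then show "a \<oplus>\<^bsub>mpoly_ring\<^esub> b \<in> M"
        using Poly_Mapping.keys_add[of a b] by (fastforce simp: M_def)
    qed auto
  qed (use mult in \<open>auto simp: mult.commute ring_axioms\<close>)
  moreover have "G \<subseteq> M"
  proof
    fix g assume g: "g \<in> G"
    then obtain s where s: "g = Poly_Mapping.single s 1" using G by (auto simp: monomials_def)
    have "s = s + 0" by simp
    with g have "\<exists>s' r. Poly_Mapping.single s' 1 \<in> G \<and> s = s' + r" unfolding s by blast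
    then show "g \<in> M" by (simp add: M_def s)
  qed
  ultimately have "Idl\<^bsub>mpoly_ring\<^esub> G \<subseteq> M" by (rule genideal_minimal)
  with u obtain t where t: "u = Poly_Mapping.single t 1" "u \<in> M" by (auto simp: monomials_def)
  then obtain s r where "Poly_Mapping.single s 1 \<in> G" "t = s + r" by (auto simp: M_def)
  then show ?thesis using t monomial_dvd_iff by blast
qed

lemma minimal_generators_eq:
  fixes G :: "('n::finite, 'a::field) mpoly set"
  assumes G: "G \<subseteq> monomials" and J: "J = Idl\<^bsub>mpoly_ring\<^esub> G"
  shows "minimal_generators J =
           {u \<in> monomials \<inter> J. \<forall>v\<in>monomials \<inter> J. v dvd u \<longrightarrow> v = u}" (is "_ = ?D")
    and "\<exists>!H. H \<subseteq> monomials \<and> Idl\<^bsub>mpoly_ring\<^esub> H = J \<and>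
           (\<forall>H'. H' \<subset> H \<longrightarrow> Idl\<^bsub>mpoly_ring\<^esub> H' \<noteq> J)"
proof -
  interpret cring "mpoly_ring :: ('n, 'a) mpoly ring" by (rule cring_mpoly_ring)
  have idJ: "ideal J mpoly_ring" unfolding J by (rule genideal_ideal) simp
  have sub: "?D \<subseteq> H" if H: "H \<subseteq> monomials" "Idl\<^bsub>mpoly_ring\<^esub> H = J" for H
  proof
    fix u assume u: "u \<in> ?D"
    then obtain g where g: "g \<in> H" "g dvd u"
      using monomial_in_genideal[OF H(1)] H(2) by blast
    have "H \<subseteq> J" using genideal_self[of H] H(2) by simp
    with u g H(1) show "u \<in> H" by blast
  qed
  have ex: "\<exists>v\<in>?D. v dvd Poly_Mapping.single t 1"
    if "Poly_Mapping.single t 1 \<in> J" for t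
    using that
  proof (induction "\<Sum>i\<in>UNIV. Poly_Mapping.lookup t i" arbitrary: t rule: less_induct)
    case less
    show ?case
    proof (cases "Poly_Mapping.single t 1 \<in> ?D")
      case True
      then show ?thesis using dvd_refl by (rule bexI[rotated])
    next
      case False
      have "(Poly_Mapping.single t 1 :: ('n, 'a) mpoly) \<in> monomials"
        by (auto simp: monomials_def)
      with False less.prems obtain v where v: "v \<in> monomials" "v \<in> J"
        "v dvd Poly_Mapping.single t 1" "v \<noteq> Poly_Mapping.single t 1"
        by blast
      then obtain s where s: "Poly_Mapping.single s 1 \<in> J"
        "Poly_Mapping.single s 1 dvd (Poly_Mapping.single t 1 :: ('n, 'a) mpoly)" "s \<noteq> t"
        unfolding monomials_def by blast
      then obtain r where r: "t = s + r" using monomial_dvd_iff by blast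
      with s have "r \<noteq> 0" by auto
      then obtain i where "Poly_Mapping.lookup r i \<noteq> 0"
        by (metis lookup_zero poly_mapping_eqI)
      then have "(\<Sum>i\<in>UNIV. Poly_Mapping.lookup s i) < (\<Sum>i\<in>UNIV. Poly_Mapping.lookup t i)"
        unfolding r by (intro sum_strict_mono_ex1) (auto simp: lookup_add)
      from less.hyps[OF this s(1)] obtain v
        where v: "v \<in> ?D" "v dvd Poly_Mapping.single s 1" ..
      from dvd_trans[OF v(2) s(2)] v(1) show ?thesis by (rule bexI)
    qed
  qed
  have gen: "Idl\<^bsub>mpoly_ring\<^esub> ?D = J"
  proof
    show "Idl\<^bsub>mpoly_ring\<^esub> ?D \<subseteq> J" using idJ by (rule genideal_minimal) auto
    have idD: "ideal (Idl\<^bsub>mpoly_ring\<^esub> ?D) mpoly_ring" by (rule genideal_ideal) simp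
    have "G \<subseteq> Idl\<^bsub>mpoly_ring\<^esub> ?D"
    proof
      fix g assume g: "g \<in> G"
      then have gJ: "g \<in> J" using genideal_self[of G] J by auto
      from g G obtain t where t: "g = Poly_Mapping.single t 1"
        unfolding monomials_def by blast
      from ex[OF gJ[unfolded t]] obtain v where v: "v \<in> ?D" "v dvd g" unfolding t ..
      then obtain k where "g = v * k" by (auto simp: dvd_def)
      moreover have "v \<in> Idl\<^bsub>mpoly_ring\<^esub> ?D" using genideal_self[of ?D] v by auto
      ultimately show "g \<in> Idl\<^bsub>mpoly_ring\<^esub> ?D"
        using ideal.I_r_closed[OF idD, of v k] by simp
    qed
    with idD show "J \<subseteq> Idl\<^bsub>mpoly_ring\<^esub> ?D" unfolding J by (rule genideal_minimal)
  qed
  define D where "D = ?D"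
  have Dmon: "D \<subseteq> monomials" unfolding D_def by blast
  note gen = gen[folded D_def] and sub = sub[folded D_def]
  have D: "D \<subseteq> monomials \<and> Idl\<^bsub>mpoly_ring\<^esub> D = J \<and>
      (\<forall>H'. H' \<subset> D \<longrightarrow> Idl\<^bsub>mpoly_ring\<^esub> H' \<noteq> J)"
  proof (intro conjI allI impI notI)
    fix H' assume H': "H' \<subset> D" "Idl\<^bsub>mpoly_ring\<^esub> H' = J"
    then have "D \<subseteq> H'" using Dmon by (intro sub) auto
    with H'(1) show False by blast
  qed (fact Dmon gen)+
  have uniq: "H = D" if H: "H \<subseteq> monomials \<and> Idl\<^bsub>mpoly_ring\<^esub> H = J \<and>
      (\<forall>H'. H' \<subset> H \<longrightarrow> Idl\<^bsub>mpoly_ring\<^esub> H' \<noteq> J)" for H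
  proof -
    have "D \<subseteq> H" using H by (intro sub) simp_all
    moreover have "\<not> D \<subset> H"
    proof
      assume "D \<subset> H"
      with H have "Idl\<^bsub>mpoly_ring\<^esub> D \<noteq> J" by simp
      with gen show False by (rule notE[rotated])
    qed
    ultimately show "H = D" by blast
  qed
  show "minimal_generators J = ?D"
    unfolding minimal_generators_def D_def[symmetric] using D uniq by (rule the_equality)
  show "\<exists>!H. H \<subseteq> monomials \<and> Idl\<^bsub>mpoly_ring\<^esub> H = J \<and>
      (\<forall>H'. H' \<subset> H \<longrightarrow> Idl\<^bsub>mpoly_ring\<^esub> H' \<noteq> J)"
    using D uniq by (rule ex1I)
qed

end

theory Submission
  imports Defs "HOL-Library.Set_Algebras"
begin

text \<open>
  Let \<open>J = I \<inter> q\<close> and \<open>L = I \<inter> (q, h)\<close>. Since the components of the given decompositions are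
  prime and irredundant, they are associated primes. Comparing \<open>J ^ k\<close> with \<open>I ^ k \<inter> q ^ k\<close>: a
  monomial in the second but not in the first has a multiple whose annihilator modulo \<open>J ^ k\<close> is
  a prime generated by variables, hence \<open>q\<close> or an associated prime of \<open>I\<close>; as \<open>q\<close> is incomparable
  to these, multiplying by a power of an element of \<open>q\<close> or \<open>I\<close> outside this prime gives a
  contradiction. So \<open>J ^ k = I ^ k \<inter> q ^ k\<close>.

  Next, \<open>L ^ k\<close> is the intersection of \<open>I ^ k\<close> and the \<open>(q, x\<^sub>r) ^ k\<close>. Take a monomial \<open>t\<close> in the
  intersection. If its degree in the variables of \<open>q\<close> is at least \<open>k\<close>, it lies in
  \<open>J ^ k \<subseteq> L ^ k\<close>. Otherwise one of the \<open>k\<close> factors of \<open>t\<close> in \<open>I\<close>, say \<open>a\<close>, has degree \<open>0\<close> in the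
  variables of \<open>q\<close>, and \<open>h\<close> divides \<open>t\<close>; splitting off \<open>a h \<in> L\<close> lowers \<open>k\<close> by one. Finally,
  \<open>(q, x\<^sub>r) ^ k\<close> is primary to \<open>(q, x\<^sub>r)\<close>, so each associated prime of \<open>L ^ k\<close> is associated to \<open>I\<close>
  or is one of the \<open>(q, x\<^sub>r)\<close>, and all of these are associated to \<open>L\<close>.
\<close>

section \<open>Coefficients of products and a monomial order\<close>

text \<open>The coefficient of a product is a convolution, and a single summand survives when
  \<open>s + t\<close> splits in only one way over the two supports. Applied to least terms for a
  monomial order and to multiplication by a monomial.\<close>

lemma lookup_mult_unique_key:
  fixes f g :: "'b::cancel_comm_monoid_add \<Rightarrow>\<^sub>0 'a::semiring_0"
  assumes "\<And>s' t'. s' \<in> Poly_Mapping.keys f \<Longrightarrow> t' \<in> Poly_Mapping.keys g \<Longrightarrow> s' + t' = s + t \<Longrightarrow> s' = s"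
  shows "Poly_Mapping.lookup (f * g) (s + t) = Poly_Mapping.lookup f s * Poly_Mapping.lookup g t"
proof -
  have "Poly_Mapping.lookup f l * (\<Sum>r. Poly_Mapping.lookup g r when s + t = l + r)
      = (Poly_Mapping.lookup f s * Poly_Mapping.lookup g t when l = s)" for l
  proof (cases "l = s")
    case True
    then show ?thesis by simp
  next
    case False
    have "Poly_Mapping.lookup f l * (\<Sum>r. Poly_Mapping.lookup g r when s + t = l + r) = 0"
    proof (cases "l \<in> Poly_Mapping.keys f")
      case True
      have "(Poly_Mapping.lookup g r when s + t = l + r) = 0" for r
        using assms[OF True, of r] False by (metis in_keys_iff when_def)
      then show ?thesis by simp
    qed (simp add: in_keys_iff)
    with False show ?thesis by simp
  qed
  then show ?thesis by (simp add: lookup_mult)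
qed

text \<open>Coordinate \<open>0\<close> of the image carries the degree in the variables of \<open>S\<close>, so that the
  lexicographic order compares this degree first.\<close>

lemma ex_degree_lex_embedding:
  fixes S :: "'n::finite set"
  shows "\<exists>\<kappa> :: ('n \<Rightarrow>\<^sub>0 nat) \<Rightarrow> (nat \<Rightarrow>\<^sub>0 nat). inj \<kappa> \<and> (\<forall>s t. \<kappa> (s + t) = \<kappa> s + \<kappa> t) \<and>
    (\<forall>s t. (\<Sum>i\<in>S. Poly_Mapping.lookup s i) < (\<Sum>i\<in>S. Poly_Mapping.lookup t i) \<longrightarrow> \<kappa> s < \<kappa> t)"
proof -
  obtain idx :: "'n \<Rightarrow> nat" where idx: "inj idx"
    using finite_imp_inj_to_nat_seg[OF finite_UNIV] by blast
  \<comment> \<open>The lexicographic order needs a linearly ordered index type, hence the numbering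
    \<open>idx\<close>. The coordinates \<open>Suc (idx i)\<close> retain the whole exponent vector,
    which makes \<kappa> injective.\<close>
  define \<kappa> :: "('n \<Rightarrow>\<^sub>0 nat) \<Rightarrow> (nat \<Rightarrow>\<^sub>0 nat)" where
    "\<kappa> t = Poly_Mapping.single 0 (\<Sum>i\<in>S. Poly_Mapping.lookup t i)
      + (\<Sum>i\<in>UNIV. Poly_Mapping.single (Suc (idx i)) (Poly_Mapping.lookup t i))" for t
  have "Poly_Mapping.lookup (\<kappa> t) (Suc (idx i)) = Poly_Mapping.lookup t i" for t i
    using idx by (simp add: \<kappa>_def lookup_add lookup_sum lookup_single inj_eq when_def)
  then have "inj \<kappa>"
    by (intro injI poly_mapping_eqI) metis
  moreover have "\<kappa> (s + t) = \<kappa> s + \<kappa> t" for s t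
    by (simp add: \<kappa>_def lookup_add sum.distrib single_add add_ac)
  moreover have "Poly_Mapping.lookup (\<kappa> t) 0 = (\<Sum>i\<in>S. Poly_Mapping.lookup t i)" for t
    by (simp add: \<kappa>_def lookup_add lookup_sum lookup_single)
  then have "(\<Sum>i\<in>S. Poly_Mapping.lookup s i) < (\<Sum>i\<in>S. Poly_Mapping.lookup t i) \<Longrightarrow> \<kappa> s < \<kappa> t" for s t
    by (auto simp: less_poly_mapping.rep_eq less_fun_def intro!: exI[of _ 0])
  ultimately show ?thesis by blast
qed

section \<open>Monomial ideals as upward closed sets of exponents\<close>

text \<open>A monomial ideal is represented by the set of exponents of its monomials.\<close>

definition exp_ideal :: "('n \<Rightarrow>\<^sub>0 nat) set \<Rightarrow> ('n, 'a::field) mpoly set" where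
  "exp_ideal U = {f. Poly_Mapping.keys f \<subseteq> U}"

definition upset :: "('n \<Rightarrow>\<^sub>0 nat) set \<Rightarrow> bool" where
  "upset U \<longleftrightarrow> (\<forall>t\<in>U. \<forall>r. t + r \<in> U)"

text \<open>These are the exponents of the \<open>k\<close>-th power of the ideal generated by the
  variables in \<open>S\<close>, see \<open>nfold_deg_ge\<close>.\<close>

definition deg_ge :: "'n set \<Rightarrow> nat \<Rightarrow> ('n \<Rightarrow>\<^sub>0 nat) set" where
  "deg_ge S k = {t. k \<le> (\<Sum>i\<in>S. Poly_Mapping.lookup t i)}"

text \<open>On exponents, multiplying ideals is elementwise addition of sets, so this is the
  \<open>k\<close>-th power of a monomial ideal. The value \<open>UNIV\<close> at 0 is the unit
  ideal.\<close>

primrec nfold :: "('n \<Rightarrow>\<^sub>0 nat) set \<Rightarrow> nat \<Rightarrow> ('n \<Rightarrow>\<^sub>0 nat) set" where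
  "nfold U 0 = UNIV"
| "nfold U (Suc k) = nfold U k + U"

lemma upsetD: "upset U \<Longrightarrow> t \<in> U \<Longrightarrow> t + r \<in> U"
  by (simp add: upset_def)

lemma upset_Int: "upset U \<Longrightarrow> upset V \<Longrightarrow> upset (U \<inter> V)"
  and upset_Un: "upset U \<Longrightarrow> upset V \<Longrightarrow> upset (U \<union> V)"
  by (auto simp: upset_def)

lemma upset_plus: "upset V \<Longrightarrow> upset (U + V)"
  unfolding upset_def set_plus_def by (force simp: add.assoc)

lemma upset_nfold: "upset U \<Longrightarrow> upset (nfold U k)"
  by (cases k) (auto simp: upset_plus, simp add: upset_def)

lemma upset_deg_ge: "upset (deg_ge S k)"
  by (auto simp: upset_def deg_ge_def lookup_add sum.distrib)

lemma deg_ge_1_iff: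
  fixes S :: "'n::finite set"
  shows "t \<in> deg_ge S 1 \<longleftrightarrow> (\<exists>i\<in>S. Poly_Mapping.lookup t i \<noteq> 0)"
  by (simp add: deg_ge_def Suc_le_eq flip: neq0_conv)

lemma nfold_mono: "U \<subseteq> V \<Longrightarrow> nfold U k \<subseteq> nfold V k"
  by (induction k) (simp_all add: set_plus_mono2)

lemma mem_exp_ideal_single: "Poly_Mapping.single t 1 \<in> exp_ideal U \<longleftrightarrow> t \<in> U"
  by (simp add: exp_ideal_def)

lemma exp_ideal_eq_iff: "exp_ideal U = exp_ideal V \<longleftrightarrow> U = V"
  by (metis mem_exp_ideal_single subsetI subset_antisym)

lemma exp_ideal_Int: "exp_ideal (U \<inter> V) = exp_ideal U \<inter> exp_ideal V"
  by (auto simp: exp_ideal_def)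

lemma exp_ideal_mono: "U \<subseteq> V \<Longrightarrow> exp_ideal U \<subseteq> exp_ideal V"
  by (auto simp: exp_ideal_def)

lemma exp_ideal_mult_mem:
  assumes "f \<in> exp_ideal U" "g \<in> exp_ideal V"
  shows "f * g \<in> exp_ideal (U + V)"
  using keys_mult[of f g] assms by (fastforce simp: exp_ideal_def set_plus_def)

text \<open>The \<kappa>-least terms of \<open>g\<close> and \<open>f\<close> have degree 0 and
  degree below \<open>k\<close> in the variables of \<open>S\<close>, and their product cannot
  cancel in \<open>g * f\<close>. For \<open>k = 1\<close> this gives primality of the ideal
  generated by these variables; for larger \<open>k\<close>, that its powers are primary.\<close>

lemma exp_ideal_mult_deg_ge_cancel:
  fixes f g :: "('n::finite, 'a::field) mpoly"
  assumes g: "g \<notin> exp_ideal (deg_ge S 1)" and gf: "g * f \<in> exp_ideal (deg_ge S k)"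
  shows "f \<in> exp_ideal (deg_ge S k)"
proof (rule ccontr)
  assume f: "f \<notin> exp_ideal (deg_ge S k)"
  let ?d = "\<lambda>t :: 'n \<Rightarrow>\<^sub>0 nat. \<Sum>i\<in>S. Poly_Mapping.lookup t i"
  obtain \<kappa> :: "('n \<Rightarrow>\<^sub>0 nat) \<Rightarrow> (nat \<Rightarrow>\<^sub>0 nat)" where inj: "inj \<kappa>"
    and add: "\<And>s t. \<kappa> (s + t) = \<kappa> s + \<kappa> t" and deg: "\<And>s t. ?d s < ?d t \<Longrightarrow> \<kappa> s < \<kappa> t"
    using ex_degree_lex_embedding[of S] by blast
  \<comment> \<open>Since \<kappa> compares the degree in \<open>S\<close> first, a \<kappa>-least
    term also has least degree in \<open>S\<close>.\<close>
  have least: "\<exists>s\<in>Poly_Mapping.keys p. (\<forall>s'\<in>Poly_Mapping.keys p. \<kappa> s \<le> \<kappa> s') \<and> ?d s < m"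
    if p: "p \<notin> exp_ideal (deg_ge S m)" for p :: "('n, 'a) mpoly" and m
  proof -
    from p obtain u where u: "u \<in> Poly_Mapping.keys p" "?d u < m"
      unfolding exp_ideal_def deg_ge_def by (auto simp: subset_iff not_le)
    obtain s where s: "s \<in> Poly_Mapping.keys p" "\<forall>s'\<in>Poly_Mapping.keys p. \<not> \<kappa> s' < \<kappa> s"
      using arg_min_if_finite[OF finite_keys, of p \<kappa>] u by blast
    with u deg[of u s] have "?d s < m" by (meson le_less_trans linorder_not_less)
    with s show ?thesis by (auto simp: not_less)
  qed
  from least[OF g] obtain s where s: "s \<in> Poly_Mapping.keys g"
    "\<And>s'. s' \<in> Poly_Mapping.keys g \<Longrightarrow> \<kappa> s \<le> \<kappa> s'" "?d s < 1" by blast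
  from least[OF f] obtain t where t: "t \<in> Poly_Mapping.keys f"
    "\<And>s'. s' \<in> Poly_Mapping.keys f \<Longrightarrow> \<kappa> t \<le> \<kappa> s'" "?d t < k" by blast
  have "Poly_Mapping.lookup (g * f) (s + t) = Poly_Mapping.lookup g s * Poly_Mapping.lookup f t"
  proof (rule lookup_mult_unique_key)
    fix s' t' assume *: "s' \<in> Poly_Mapping.keys g" "t' \<in> Poly_Mapping.keys f" "s' + t' = s + t"
    \<comment> \<open>Otherwise \<kappa> would be strictly larger at \<open>s' + t'\<close> than at
      \<open>s + t\<close>, as \<open>t\<close> is least too.\<close>
    have "\<not> \<kappa> s < \<kappa> s'"
      using add_less_le_mono[of "\<kappa> s" "\<kappa> s'" "\<kappa> t" "\<kappa> t'"] t(2)[OF *(2)] *(3) by (metis add less_irrefl)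
    with s(2)[OF *(1)] have "\<kappa> s' = \<kappa> s" by simp
    with inj show "s' = s" by (simp add: inj_eq)
  qed
  with s(1) t(1) have "s + t \<in> Poly_Mapping.keys (g * f)" by (simp add: in_keys_iff)
  with gf have "k \<le> ?d (s + t)" by (auto simp: exp_ideal_def deg_ge_def)
  with s(3) t(3) show False by (simp add: lookup_add sum.distrib)
qed

lemma ideal_exp_ideal:
  fixes U :: "('n \<Rightarrow>\<^sub>0 nat) set"
  assumes "upset U"
  shows "ideal (exp_ideal U :: ('n, 'a::field) mpoly set) mpoly_ring"
proof -
  interpret cring "mpoly_ring :: ('n, 'a) mpoly ring" by (rule cring_mpoly_ring)
  have mult: "x * a \<in> exp_ideal U" if "a \<in> exp_ideal U" for a x :: "('n, 'a) mpoly"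
    using keys_mult[of x a] that assms by (fastforce simp: exp_ideal_def upset_def add.commute)
  show ?thesis
  proof (rule idealI)
    show "subgroup (exp_ideal U) (add_monoid (mpoly_ring :: ('n, 'a) mpoly ring))"
    proof (rule add.subgroupI)
      have "(0 :: ('n, 'a) mpoly) \<in> exp_ideal U" by (simp add: exp_ideal_def)
      then show "(exp_ideal U :: ('n, 'a) mpoly set) \<noteq> {}" by blast
    next
      fix a :: "('n, 'a) mpoly" assume a: "a \<in> exp_ideal U"
      have "\<ominus>\<^bsub>mpoly_ring\<^esub> a = - a"
        using r_neg[of a] by (simp add: add_eq_0_iff)
      then show "\<ominus>\<^bsub>mpoly_ring\<^esub> a \<in> exp_ideal U" using mult[OF a, of "-1"] by simp
    next
      fix a b :: "('n, 'a) mpoly" assume "a \<in> exp_ideal U" "b \<in> exp_ideal U"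
      then show "a \<oplus>\<^bsub>mpoly_ring\<^esub> b \<in> exp_ideal U"
        using Poly_Mapping.keys_add[of a b] by (fastforce simp: exp_ideal_def)
    qed auto
  qed (use mult in \<open>auto simp: mult.commute ring_axioms\<close>)
qed

text \<open>A polynomial is the sum of its terms, and each term is a monomial times a constant
  \<open>Poly_Mapping.single 0 c\<close>. Inclusions of monomial ideals are thereby checked on
  monomials only.\<close>

lemma exp_ideal_subset_ideal:
  fixes A :: "('n, 'a::field) mpoly set"
  assumes A: "ideal A mpoly_ring" and U: "\<And>t. t \<in> U \<Longrightarrow> Poly_Mapping.single t 1 \<in> A"
  shows "exp_ideal U \<subseteq> A"
proof
  fix f :: "('n, 'a) mpoly" assume f: "f \<in> exp_ideal U"
  interpret ideal A "mpoly_ring :: ('n, 'a) mpoly ring" by fact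
  have "f = (\<Sum>t\<in>Poly_Mapping.keys f. Poly_Mapping.single t (Poly_Mapping.lookup f t))"
    by (rule poly_mapping_eqI) (auto simp: lookup_sum lookup_single when_def in_keys_iff)
  also have "\<dots> \<in> A"
    using finite_keys[of f] f[unfolded exp_ideal_def, simplified]
  proof (induction rule: finite_subset_induct)
    case empty
    then show ?case using additive_subgroup.zero_closed[OF is_additive_subgroup] by simp
  next
    case (insert t F)
    have "Poly_Mapping.single 0 (Poly_Mapping.lookup f t) * Poly_Mapping.single t 1 \<in> A"
      using I_l_closed[OF U[OF insert(2)], of "Poly_Mapping.single 0 (Poly_Mapping.lookup f t)"] by simp
    then have "Poly_Mapping.single t (Poly_Mapping.lookup f t) \<in> A" by (simp add: mult_single)
    with insert show ?case using additive_subgroup.a_closed[OF is_additive_subgroup] by fastforce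
  qed
  finally show "f \<in> A" .
qed

lemma ideal_prod_exp_ideal:
  assumes "upset U" "upset V"
  shows "ideal_prod mpoly_ring (exp_ideal U) (exp_ideal V) = (exp_ideal (U + V) :: ('n, 'a::field) mpoly set)"
proof
  interpret cring "mpoly_ring :: ('n, 'a) mpoly ring" by (rule cring_mpoly_ring)
  interpret UV: ideal "exp_ideal (U + V)" "mpoly_ring :: ('n, 'a) mpoly ring"
    using assms by (intro ideal_exp_ideal upset_plus)
  show "ideal_prod mpoly_ring (exp_ideal U) (exp_ideal V) \<subseteq> (exp_ideal (U + V) :: ('n, 'a) mpoly set)"
  proof
    fix x :: "('n, 'a) mpoly" assume "x \<in> ideal_prod mpoly_ring (exp_ideal U) (exp_ideal V)"
    then show "x \<in> exp_ideal (U + V)"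
      by induction (use UV.a_closed in \<open>auto intro: exp_ideal_mult_mem\<close>)
  qed
  show "exp_ideal (U + V) \<subseteq> ideal_prod mpoly_ring (exp_ideal U) (exp_ideal V :: ('n, 'a) mpoly set)"
  proof (rule exp_ideal_subset_ideal)
    show "ideal (ideal_prod mpoly_ring (exp_ideal U) (exp_ideal V)) (mpoly_ring :: ('n, 'a) mpoly ring)"
      using assms by (intro ideal_prod_is_ideal ideal_exp_ideal)
    fix t assume "t \<in> U + V"
    then obtain a b where "t = a + b" "a \<in> U" "b \<in> V" by (auto simp: set_plus_def)
    then show "Poly_Mapping.single t 1 \<in> ideal_prod mpoly_ring (exp_ideal U) (exp_ideal V :: ('n, 'a) mpoly set)"
      using ideal_prod.prod[of "Poly_Mapping.single a 1" "exp_ideal U" "Poly_Mapping.single b 1" "exp_ideal V :: ('n, 'a) mpoly set" mpoly_ring]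
      by (simp add: exp_ideal_def mult_single)
  qed
qed

lemma ideal_power_exp_ideal:
  assumes "upset U"
  shows "exp_ideal U [^]\<^bsub>ideals_set mpoly_ring\<^esub> k = (exp_ideal (nfold U k) :: ('n, 'a::field) mpoly set)"
proof (induction k)
  case 0
  show ?case by (simp add: nat_pow_def ideals_set_def exp_ideal_def)
next
  case (Suc k)
  have "exp_ideal U [^]\<^bsub>ideals_set mpoly_ring\<^esub> Suc k
      = ideal_prod mpoly_ring (exp_ideal U [^]\<^bsub>ideals_set mpoly_ring\<^esub> k) (exp_ideal U :: ('n, 'a) mpoly set)"
    by (simp add: nat_pow_def ideals_set_def)
  with Suc assms show ?case by (simp add: ideal_prod_exp_ideal upset_nfold)
qed

lemma genideal_monomials:
  fixes G :: "('n, 'a::field) mpoly set"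
  assumes "G \<subseteq> monomials"
  shows "Idl\<^bsub>mpoly_ring\<^esub> G = exp_ideal {t. \<exists>s r. Poly_Mapping.single s 1 \<in> G \<and> t = s + r}" (is "_ = exp_ideal ?U")
proof
  interpret cring "mpoly_ring :: ('n, 'a) mpoly ring" by (rule cring_mpoly_ring)
  have "upset ?U" by (auto simp: upset_def add.assoc)
  moreover have "g \<in> exp_ideal ?U" if g: "g \<in> G" for g
  proof -
    from g assms obtain s where s: "g = Poly_Mapping.single s 1" by (auto simp: monomials_def)
    have "s = s + 0" by simp
    with g have "s \<in> ?U" unfolding s by blast
    then show ?thesis by (simp add: s exp_ideal_def)
  qed
  ultimately show "Idl\<^bsub>mpoly_ring\<^esub> G \<subseteq> exp_ideal ?U"
    by (intro genideal_minimal ideal_exp_ideal) auto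
  have ideal: "ideal (Idl\<^bsub>mpoly_ring\<^esub> G) mpoly_ring" by (rule genideal_ideal) simp
  then show "exp_ideal ?U \<subseteq> Idl\<^bsub>mpoly_ring\<^esub> G"
  proof (rule exp_ideal_subset_ideal)
    fix t assume "t \<in> ?U"
    then obtain s r where *: "Poly_Mapping.single s 1 \<in> G" "t = s + r" by blast
    then show "Poly_Mapping.single t 1 \<in> Idl\<^bsub>mpoly_ring\<^esub> G"
      using ideal.I_r_closed[OF ideal, of "Poly_Mapping.single s 1" "Poly_Mapping.single r 1"] genideal_self[of G]
      by (auto simp: mult_single)
  qed
qed

lemma set_add_exp_ideal:
  assumes "upset U" "upset V"
  shows "exp_ideal U <+>\<^bsub>mpoly_ring\<^esub> exp_ideal V = (exp_ideal (U \<union> V) :: ('n, 'a::field) mpoly set)"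
proof
  interpret cring "mpoly_ring :: ('n, 'a) mpoly ring" by (rule cring_mpoly_ring)
  show "exp_ideal U <+>\<^bsub>mpoly_ring\<^esub> exp_ideal V \<subseteq> (exp_ideal (U \<union> V) :: ('n, 'a) mpoly set)"
    using Poly_Mapping.keys_add by (fastforce simp: exp_ideal_def set_add_def set_mult_def)
  show "exp_ideal (U \<union> V) \<subseteq> exp_ideal U <+>\<^bsub>mpoly_ring\<^esub> (exp_ideal V :: ('n, 'a) mpoly set)"
  proof (rule exp_ideal_subset_ideal)
    show "ideal (exp_ideal U <+>\<^bsub>mpoly_ring\<^esub> exp_ideal V) (mpoly_ring :: ('n, 'a) mpoly ring)"
      using assms by (intro add_ideals ideal_exp_ideal)
    fix t assume t: "t \<in> U \<union> V"
    have sum: "a + b \<in> exp_ideal U <+>\<^bsub>mpoly_ring\<^esub> exp_ideal V" if "a \<in> exp_ideal U" "b \<in> exp_ideal V" for a b :: "('n, 'a) mpoly"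
      using that by (auto simp: set_add_def set_mult_def)
    have 0: "(0 :: ('n, 'a) mpoly) \<in> exp_ideal W" for W by (simp add: exp_ideal_def)
    show "Poly_Mapping.single t 1 \<in> exp_ideal U <+>\<^bsub>mpoly_ring\<^esub> (exp_ideal V :: ('n, 'a) mpoly set)"
      using sum[OF _ 0, of "Poly_Mapping.single t 1"] sum[OF 0, of "Poly_Mapping.single t 1"] t
      by (auto simp: mem_exp_ideal_single)
  qed
qed

text \<open>Multiplication by a monomial shifts the support without cancellation, so the colon by a
  monomial can be computed on exponents.\<close>

lemma mult_single_mem_exp_ideal:
  "f * Poly_Mapping.single t 1 \<in> exp_ideal U \<longleftrightarrow> f \<in> exp_ideal {s. s + t \<in> U}"
proof
  assume *: "f * Poly_Mapping.single t 1 \<in> exp_ideal U"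
  have "s + t \<in> U" if s: "s \<in> Poly_Mapping.keys f" for s
  proof -
    have "Poly_Mapping.lookup (f * Poly_Mapping.single t 1) (s + t)
        = Poly_Mapping.lookup f s * Poly_Mapping.lookup (Poly_Mapping.single t 1) t"
      by (rule lookup_mult_unique_key) auto
    with s have "s + t \<in> Poly_Mapping.keys (f * Poly_Mapping.single t 1)"
      by (simp add: in_keys_iff)
    with * show ?thesis by (auto simp: exp_ideal_def)
  qed
  then show "f \<in> exp_ideal {s. s + t \<in> U}" by (auto simp: exp_ideal_def)
next
  assume *: "f \<in> exp_ideal {s. s + t \<in> U}"
  then show "f * Poly_Mapping.single t 1 \<in> exp_ideal U"
    using keys_mult[of f "Poly_Mapping.single t 1"] by (fastforce simp: exp_ideal_def)
qed

section \<open>Ideals generated by variables and their powers\<close>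

lemma primeideal_exp_ideal_deg_ge:
  fixes S :: "'n::finite set"
  shows "primeideal (exp_ideal (deg_ge S 1) :: ('n, 'a::field) mpoly set) mpoly_ring"
proof (rule primeidealI)
  show "ideal (exp_ideal (deg_ge S 1)) (mpoly_ring :: ('n, 'a) mpoly ring)"
    by (intro ideal_exp_ideal upset_deg_ge)
  show "carrier mpoly_ring \<noteq> (exp_ideal (deg_ge S 1) :: ('n, 'a) mpoly set)"
  proof
    assume "carrier mpoly_ring = (exp_ideal (deg_ge S 1) :: ('n, 'a) mpoly set)"
    then have "(1 :: ('n, 'a) mpoly) \<in> exp_ideal (deg_ge S 1)" by auto
    then show False by (simp add: exp_ideal_def deg_ge_def)
  qed
  show "a \<in> exp_ideal (deg_ge S 1) \<or> b \<in> exp_ideal (deg_ge S 1)"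
    if "a \<otimes>\<^bsub>mpoly_ring\<^esub> b \<in> exp_ideal (deg_ge S 1)" for a b :: "('n, 'a) mpoly"
    using that exp_ideal_mult_deg_ge_cancel[of a S b 1] by auto
qed (rule cring_mpoly_ring)

lemma nfold_deg_ge:
  fixes S :: "'n::finite set"
  shows "nfold (deg_ge S 1) k = deg_ge S k"
proof (induction k)
  case (Suc k)
  show ?case
  proof (intro equalityI subsetI)
    fix t assume "t \<in> nfold (deg_ge S 1) (Suc k)"
    with Suc show "t \<in> deg_ge S (Suc k)"
      by (fastforce simp: deg_ge_def set_plus_def lookup_add sum.distrib)
  next
    fix t assume t: "t \<in> deg_ge S (Suc k)"
    then have "t \<in> deg_ge S 1" by (simp add: deg_ge_def)
    then obtain i where i: "i \<in> S" "Poly_Mapping.lookup t i \<noteq> 0" unfolding deg_ge_1_iff by blast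
    let ?e = "Poly_Mapping.single i (1::nat)"
    have t_eq: "t = (t - ?e) + ?e"
      using i(2) by (intro poly_mapping_eqI) (auto simp: lookup_add lookup_minus lookup_single when_def)
    have "(\<Sum>j\<in>S. Poly_Mapping.lookup t j) = (\<Sum>j\<in>S. Poly_Mapping.lookup (t - ?e) j) + 1"
      using i(1) by (subst t_eq) (simp add: lookup_add sum.distrib lookup_single when_def)
    with t have "t - ?e \<in> deg_ge S k" by (simp add: deg_ge_def)
    moreover have "?e \<in> deg_ge S 1"
      using i(1) unfolding deg_ge_1_iff by (intro bexI[of _ i]) simp_all
    ultimately have "(t - ?e) + ?e \<in> nfold (deg_ge S 1) (Suc k)"
      using Suc by (auto simp: set_plus_def)
    then show "t \<in> nfold (deg_ge S 1) (Suc k)" using t_eq by simp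
  qed
qed (simp add: deg_ge_def)

lemma power_mem_exp_ideal_deg_ge:
  fixes g :: "('n::finite, 'a::field) mpoly"
  assumes "g \<in> exp_ideal (deg_ge S 1)"
  shows "g ^ k \<in> exp_ideal (deg_ge S k)"
proof -
  have "g ^ k \<in> exp_ideal (nfold (deg_ge S 1) k)"
  proof (induction k)
    case (Suc k)
    then show ?case using exp_ideal_mult_mem[OF Suc assms] by (simp add: mult.commute)
  qed (simp add: exp_ideal_def)
  then show ?thesis by (simp only: nfold_deg_ge)
qed

section \<open>Associated primes, intersections and irredundant components\<close>

lemma Ass_exp_ideal_iff:
  fixes P :: "('n, 'a::field) mpoly set"
  assumes "upset U"
  shows "P \<in> Ass mpoly_ring (exp_ideal U) \<longleftrightarrow>
    primeideal P mpoly_ring \<and> (\<exists>f. P = {g. g * f \<in> exp_ideal U})"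
  using Ass_iff_colon[OF cring_mpoly_ring ideal_exp_ideal[OF assms]] by simp

text \<open>The colon \<open>P\<close> contains the \<open>k\<close>-th power of each element of the
  ideal of \<open>S\<close>, hence by primality the element; the cancellation lemma gives the
  converse. For \<open>k = 0\<close> the ideal is the whole ring and has no associated primes, so
  equality fails there.\<close>

lemma Ass_deg_ge:
  fixes S :: "'n::finite set"
  shows "Ass mpoly_ring (exp_ideal (deg_ge S k) :: ('n, 'a::field) mpoly set) \<subseteq> {exp_ideal (deg_ge S 1)}"
proof
  fix P :: "('n, 'a) mpoly set" assume "P \<in> Ass mpoly_ring (exp_ideal (deg_ge S k))"
  then obtain f where prime: "primeideal P mpoly_ring" and P: "P = {g. g * f \<in> exp_ideal (deg_ge S k)}"
    by (auto simp: Ass_exp_ideal_iff[OF upset_deg_ge])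
  interpret primeideal P "mpoly_ring :: ('n, 'a) mpoly ring" by fact
  interpret Q: ideal "exp_ideal (deg_ge S k)" "mpoly_ring :: ('n, 'a) mpoly ring"
    by (intro ideal_exp_ideal upset_deg_ge)
  have f: "f \<notin> exp_ideal (deg_ge S k)"
    using Q.I_l_closed[of f] I_notcarr P by auto
  have "g \<in> P" if g: "g \<in> exp_ideal (deg_ge S 1)" for g
  proof -
    have "g ^ k \<in> P"
      using Q.I_r_closed[OF power_mem_exp_ideal_deg_ge[OF g], of f] P by simp
    moreover have "1 \<notin> P" using f P by simp
    ultimately show "g \<in> P"
    proof (induction k)
      case (Suc k)
      then show ?case using I_prime[of g "g ^ k"] by auto
    qed simp
  qed
  moreover have "g \<in> exp_ideal (deg_ge S 1)" if "g \<in> P" for g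
    using exp_ideal_mult_deg_ge_cancel[of g S f k] f that P by auto
  ultimately show "P \<in> {exp_ideal (deg_ge S 1)}" by blast
qed

text \<open>The colon of an intersection is the intersection of the colons, and a prime that is the
  intersection of two ideals equals one of them.\<close>

lemma Ass_Int_subset:
  assumes R: "cring R" and I: "ideal I R" and J: "ideal J R"
  shows "Ass R (I \<inter> J) \<subseteq> Ass R I \<union> Ass R J"
proof
  fix P assume P: "P \<in> Ass R (I \<inter> J)"
  interpret cring R by fact
  interpret I: ideal I R by fact
  interpret J: ideal J R by fact
  obtain f where f: "f \<in> carrier R" and prime: "primeideal P R"
    and eq: "P = {r \<in> carrier R. r \<otimes>\<^bsub>R\<^esub> f \<in> I \<inter> J}"
    using P Ass_iff_colon[OF R i_intersect[OF I J]] by blast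
  let ?A = "{r \<in> carrier R. r \<otimes>\<^bsub>R\<^esub> f \<in> I}" and ?B = "{r \<in> carrier R. r \<otimes>\<^bsub>R\<^esub> f \<in> J}"
  have "P = ?A \<or> P = ?B"
  proof (rule ccontr)
    assume "\<not> (P = ?A \<or> P = ?B)"
    moreover have "P \<subseteq> ?A" "P \<subseteq> ?B" by (auto simp: eq)
    ultimately obtain a b where ab: "a \<in> ?A" "a \<notin> P" "b \<in> ?B" "b \<notin> P" by blast
    then have "a \<otimes>\<^bsub>R\<^esub> b \<otimes>\<^bsub>R\<^esub> f \<in> I" "a \<otimes>\<^bsub>R\<^esub> b \<otimes>\<^bsub>R\<^esub> f \<in> J"
      using I.I_l_closed[of "a \<otimes>\<^bsub>R\<^esub> f" b] J.I_l_closed[of "b \<otimes>\<^bsub>R\<^esub> f" a] f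
      by (auto simp: m_ac)
    with ab have "a \<otimes>\<^bsub>R\<^esub> b \<in> P" by (auto simp: eq)
    with primeideal.I_prime[OF prime, of a b] ab show False by auto
  qed
  then show "P \<in> Ass R I \<union> Ass R J"
    using Ass_iff_colon[OF R I] Ass_iff_colon[OF R J] prime f by blast
qed

text \<open>Irredundance supplies an \<open>f\<close> in all other components but not in
  \<open>Q j\<close>. Since \<open>Q j\<close> is prime, it is exactly the annihilator of
  \<open>f\<close> modulo \<open>J\<close>.\<close>

lemma primary_component_in_Ass:
  assumes R: "cring R" and J: "ideal J R" and dec: "minimal_primary_decomposition R A Q J"
    and j: "j \<in> A" and prime: "primeideal (Q j) R"
  shows "Q j \<in> Ass R J"
proof -
  interpret primeideal "Q j" R by fact
  have J_eq: "J = carrier R \<inter> (\<Inter>i\<in>A. Q i)" and "carrier R \<inter> (\<Inter>i\<in>A - {j}. Q i) \<noteq> J"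
    and "\<forall>i\<in>A. ideal (Q i) R"
    using dec j by (auto simp: minimal_primary_decomposition_def primary_ideal_def)
  then obtain f where f: "f \<in> carrier R" "\<forall>i\<in>A - {j}. f \<in> Q i" "f \<notin> Q j" by blast
  have "Q j = {r \<in> carrier R. r \<otimes>\<^bsub>R\<^esub> f \<in> J}"
  proof (intro equalityI subsetI)
    fix r assume r: "r \<in> Q j"
    have "r \<otimes>\<^bsub>R\<^esub> f \<in> Q i" if "i \<in> A" for i
      using that r f \<open>\<forall>i\<in>A. ideal (Q i) R\<close> ideal.I_l_closed[of "Q i" R f r] I_r_closed[of r f] Icarr
      by (cases "i = j") auto
    with r f show "r \<in> {r \<in> carrier R. r \<otimes>\<^bsub>R\<^esub> f \<in> J}" by (auto simp: J_eq Icarr)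
  next
    fix r assume "r \<in> {r \<in> carrier R. r \<otimes>\<^bsub>R\<^esub> f \<in> J}"
    with I_prime[of r f] f j show "r \<in> Q j" by (auto simp: J_eq)
  qed
  with f prime show ?thesis using Ass_iff_colon[OF R J] by blast
qed

text \<open>A component containing another one could be omitted.\<close>

lemma primary_components_incomparable:
  assumes dec: "minimal_primary_decomposition R A Q J" and "i \<in> A" "j \<in> A" "i \<noteq> j"
  shows "\<not> Q i \<subseteq> Q j"
proof
  assume "Q i \<subseteq> Q j"
  with assms(2-) have "(\<Inter>i\<in>A - {j}. Q i) = (\<Inter>i\<in>A. Q i)" by blast
  with dec \<open>j \<in> A\<close> show False
    unfolding minimal_primary_decomposition_def by blast
qed

section \<open>Truncated exponents and colons generated by variables\<close>

text \<open>For \<open>c = 1\<close> this says that \<open>U\<close> is spanned by squarefree exponents, and \<open>c i = 0\<close> says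
  that the generators do not involve the variable \<open>i\<close>.\<close>

definition capped :: "('n \<Rightarrow> nat) \<Rightarrow> ('n \<Rightarrow>\<^sub>0 nat) set \<Rightarrow> bool" where
  "capped c U \<longleftrightarrow> (\<forall>t\<in>U. \<forall>s.
     (\<forall>i. min (c i) (Poly_Mapping.lookup t i) \<le> Poly_Mapping.lookup s i) \<longrightarrow> s \<in> U)"

lemma cappedD:
  "capped c U \<Longrightarrow> t \<in> U \<Longrightarrow> (\<And>i. min (c i) (Poly_Mapping.lookup t i) \<le> Poly_Mapping.lookup s i) \<Longrightarrow> s \<in> U"
  by (auto simp: capped_def)

lemma upset_capped: "capped c U \<Longrightarrow> upset U"
  unfolding upset_def by (auto simp: lookup_add intro: cappedD)

lemma capped_Int: "capped c U \<Longrightarrow> capped c V \<Longrightarrow> capped c (U \<inter> V)"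
  unfolding capped_def by blast

lemma capped_deg_ge_1:
  fixes S :: "'n::finite set"
  shows "capped (\<lambda>_. 1) (deg_ge S 1)"
  unfolding capped_def
proof (intro ballI allI impI)
  fix t s :: "'n \<Rightarrow>\<^sub>0 nat"
  assume "t \<in> deg_ge S 1"
    and s: "\<forall>i. min 1 (Poly_Mapping.lookup t i) \<le> Poly_Mapping.lookup s i"
  then obtain i where i: "i \<in> S" "Poly_Mapping.lookup t i \<noteq> 0"
    unfolding deg_ge_1_iff by blast
  with s[rule_format, of i] have "Poly_Mapping.lookup s i \<noteq> 0" by linarith
  with i(1) show "s \<in> deg_ge S 1" unfolding deg_ge_1_iff by blast
qed

text \<open>A factor from \<open>U\<close> may be truncated at \<open>c\<close> before it is split
  off; the bounds for it and for the other \<open>k\<close> factors add up to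
  \<open>Suc k * c i\<close>. This makes \<open>ex_variables_colon\<close> applicable to
  powers.\<close>

lemma capped_nfold:
  fixes U :: "('n::finite \<Rightarrow>\<^sub>0 nat) set"
  assumes U: "capped c U"
  shows "capped (\<lambda>i. k * c i) (nfold U k)"
proof (induction k)
  case (Suc k)
  show ?case
    unfolding capped_def
  proof (intro ballI allI impI)
    fix t s assume t: "t \<in> nfold U (Suc k)"
      and s: "\<forall>i. min (Suc k * c i) (Poly_Mapping.lookup t i) \<le> Poly_Mapping.lookup s i"
    from t obtain a b where t_eq: "t = a + b" and a: "a \<in> nfold U k" and b: "b \<in> U"
      by (auto simp: set_plus_def)
    define b' where "b' = Poly_Mapping.Abs_poly_mapping (\<lambda>i. min (c i) (Poly_Mapping.lookup b i))"
    have b': "Poly_Mapping.lookup b' i = min (c i) (Poly_Mapping.lookup b i)" for i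
      by (simp add: b'_def)
    have le: "min (k * c i) (Poly_Mapping.lookup a i) + Poly_Mapping.lookup b' i \<le> Poly_Mapping.lookup s i" for i
      using s[rule_format, of i] by (auto simp: t_eq lookup_add b' min_def split: if_splits)
    have "s - b' \<in> nfold U k"
      using Suc a
    proof (rule cappedD)
      show "min (k * c i) (Poly_Mapping.lookup a i) \<le> Poly_Mapping.lookup (s - b') i" for i
        using le[of i] by (simp add: lookup_minus)
    qed
    moreover have "b' \<in> U" using U b by (rule cappedD) (simp add: b')
    moreover have "s = (s - b') + b'"
    proof (rule poly_mapping_eqI)
      show "Poly_Mapping.lookup s i = Poly_Mapping.lookup (s - b' + b') i" for i
        using le[of i] by (simp add: lookup_add lookup_minus)
    qed
    ultimately show "s \<in> nfold U (Suc k)" by (auto simp: set_plus_def)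
  qed
qed (simp add: capped_def)

text \<open>Among the multiples of \<open>t\<close> outside \<open>U\<close> take one, \<open>u\<close>, maximising
  \<open>\<Sum>i. min (c i) (u i)\<close>. A variable that does not carry \<open>u\<close> into \<open>U\<close> then has \<open>c i \<le> u i\<close>,
  so multiplying by it does not matter for membership in \<open>U\<close>.\<close>

lemma ex_variables_colon:
  fixes U :: "('n::finite \<Rightarrow>\<^sub>0 nat) set"
  assumes U: "capped c U" and t: "t \<notin> U"
  obtains r V where "t + r \<notin> U" "{s. s + (t + r) \<in> U} = deg_ge V 1"
    "\<And>i. i \<in> V \<Longrightarrow> Poly_Mapping.lookup t i < c i"
proof -
  define m where "m = (\<lambda>r. \<Sum>i\<in>UNIV. min (c i) (Poly_Mapping.lookup (t + r) i))"
  have "m r \<le> (\<Sum>i\<in>UNIV. c i)" for r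
    unfolding m_def by (intro sum_mono) simp
  \<comment> \<open>The bound on \<open>m\<close> does not depend on \<open>r\<close>, so a maximum
    exists among infinitely many multiples; \<open>Suc\<close> makes the bound strict.\<close>
  then have "\<exists>r. t + r \<notin> U \<and> (\<forall>r'. t + r' \<notin> U \<longrightarrow> m r' \<le> m r)"
    using ex_has_greatest_nat[of "\<lambda>r. t + r \<notin> U" 0 m "Suc (\<Sum>i\<in>UNIV. c i)"] t
    by (auto simp: less_Suc_eq_le)
  then obtain r where r: "t + r \<notin> U" and max: "\<And>r'. t + r' \<notin> U \<Longrightarrow> m r' \<le> m r" by blast
  define u where "u = t + r"
  define V where "V = {i. u + Poly_Mapping.single i 1 \<in> U}"
  \<comment> \<open>If \<open>c i \<le> u i\<close>, another factor \<open>i\<close> would not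
    change the truncation of \<open>u\<close>. As \<open>t\<close> divides \<open>u\<close>, this
    confines \<open>V\<close> once \<open>t\<close> is chosen large outside a prescribed set of
    variables.\<close>
  have small: "Poly_Mapping.lookup u i < c i" if "i \<in> V" for i
  proof (rule ccontr)
    assume *: "\<not> Poly_Mapping.lookup u i < c i"
    from that have "u + Poly_Mapping.single i 1 \<in> U" by (simp add: V_def)
    then have "u \<in> U"
      by (rule cappedD[OF U]) (use * in \<open>auto simp: lookup_add lookup_single when_def\<close>)
    with r show False by (simp add: u_def)
  qed
  have large: "c i \<le> Poly_Mapping.lookup u i" if "i \<notin> V" for i
  proof (rule ccontr)
    assume less: "\<not> c i \<le> Poly_Mapping.lookup u i"
    let ?r = "r + Poly_Mapping.single i 1"
    have "m r < m ?r"
      unfolding m_def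
    proof (rule sum_strict_mono_ex1)
      show "\<forall>j\<in>UNIV. min (c j) (Poly_Mapping.lookup (t + r) j) \<le> min (c j) (Poly_Mapping.lookup (t + ?r) j)"
        by (auto simp: lookup_add min_le_iff_disj)
      show "\<exists>j\<in>UNIV. min (c j) (Poly_Mapping.lookup (t + r) j) < min (c j) (Poly_Mapping.lookup (t + ?r) j)"
        using less by (intro bexI[of _ i]) (auto simp: u_def lookup_add)
    qed simp
    moreover from that have "t + ?r \<notin> U" by (simp add: V_def u_def add.assoc)
    ultimately show False using max[of ?r] by simp
  qed
  have "s + u \<in> U \<longleftrightarrow> s \<in> deg_ge V 1" for s
  proof
    assume s: "s + u \<in> U"
    show "s \<in> deg_ge V 1"
    proof (rule ccontr)
      assume "s \<notin> deg_ge V 1"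
      then have "Poly_Mapping.lookup s i = 0" if "i \<in> V" for i
        using that unfolding deg_ge_1_iff by blast
      then have "min (c i) (Poly_Mapping.lookup (s + u) i) \<le> Poly_Mapping.lookup u i" for i
        using large[of i] by (cases "i \<in> V") (auto simp: lookup_add)
      with cappedD[OF U s] r show False by (simp add: u_def)
    qed
  next
    assume "s \<in> deg_ge V 1"
    then obtain i where i: "i \<in> V" "Poly_Mapping.lookup s i \<noteq> 0"
      unfolding deg_ge_1_iff by blast
    then have "u + Poly_Mapping.single i 1 \<in> U" by (simp add: V_def)
    then show "s + u \<in> U"
      by (rule cappedD[OF U]) (use i in \<open>auto simp: lookup_add lookup_single when_def min_le_iff_disj\<close>)
  qed
  then have "{s. s + (t + r) \<in> U} = deg_ge V 1" by (auto simp: u_def)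
  moreover have "Poly_Mapping.lookup t i < c i" if "i \<in> V" for i
    using small[OF that] by (simp add: u_def lookup_add)
  ultimately show ?thesis using that[of r V] r by blast
qed

lemma colon_variables_in_Ass:
  fixes U :: "('n::finite \<Rightarrow>\<^sub>0 nat) set"
  assumes U: "upset U" and eq: "{s. s + u \<in> U} = deg_ge V 1"
  shows "(exp_ideal (deg_ge V 1) :: ('n, 'a::field) mpoly set) \<in> Ass mpoly_ring (exp_ideal U)"
proof -
  have "exp_ideal (deg_ge V 1) = {g :: ('n, 'a) mpoly. g * Poly_Mapping.single u 1 \<in> exp_ideal U}"
    by (simp add: mult_single_mem_exp_ideal eq)
  with primeideal_exp_ideal_deg_ge show ?thesis
    unfolding Ass_exp_ideal_iff[OF U] by blast
qed

section \<open>Distributing and splitting the factors of a power\<close>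

text \<open>The sum is the exponent of a \<open>k\<close>-th power; its \<open>k\<close> copies of
  \<open>s\<close> are handed out, one to each factor of \<open>t\<close>.\<close>

lemma nfold_add_multiple:
  assumes "upset U" "upset V" "t \<in> nfold U k" "s \<in> V"
  shows "t + (\<Sum>j<k. s) \<in> nfold (U \<inter> V) k"
  using assms(3)
proof (induction k arbitrary: t)
  case (Suc k)
  then obtain a b where t: "t = a + b" "a \<in> nfold U k" "b \<in> U"
    by (auto simp: set_plus_def)
  have "b + s \<in> U \<inter> V"
    using assms t(3) upsetD[of U b s] upsetD[of V s b] by (simp add: add.commute)
  with Suc.IH[OF t(2)] have "(a + (\<Sum>j<k. s)) + (b + s) \<in> nfold (U \<inter> V) (Suc k)"
    by (auto simp: set_plus_def)
  then show ?case by (simp add: t(1) add_ac)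
qed simp

text \<open>Pigeonhole: if all \<open>Suc k\<close> factors had positive degree in \<open>S\<close>,
  the degree of \<open>t\<close> would be at least \<open>Suc k\<close>.\<close>

lemma nfold_split_degree_0:
  assumes "upset U" and "t \<in> nfold U (Suc k)" and "t \<notin> deg_ge S (Suc k)"
  shows "\<exists>a b. t = a + b \<and> a \<in> U \<and> a \<notin> deg_ge S 1 \<and> b \<in> nfold U k"
  using assms(2-)
proof (induction k arbitrary: t)
  case 0
  then obtain a b where t: "t = a + b" "b \<in> U" by (auto simp: set_plus_def)
  with assms(1) have "t \<in> U" using upsetD[of U b a] by (simp add: add.commute)
  with 0 show ?case by (intro exI[of _ t] exI[of _ 0]) auto
next
  case (Suc k)
  obtain b a where t: "t = b + a" "b \<in> nfold U (Suc k)" "a \<in> U"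
    using Suc.prems(1) unfolding nfold.simps(2)[of U "Suc k"] by (rule set_plus_elim)
  show ?case
  proof (cases "a \<in> deg_ge S 1")
    case True
    with Suc.prems(2) have "b \<notin> deg_ge S (Suc k)"
      by (simp add: t deg_ge_def lookup_add sum.distrib)
    from Suc.IH[OF t(2) this] obtain a' b' where b: "b = a' + b'" "a' \<in> U" "a' \<notin> deg_ge S 1" "b' \<in> nfold U k"
      by blast
    have "b' + a \<in> nfold U (Suc k)" using b t by (auto simp: set_plus_def)
    with b show ?thesis by (intro exI[of _ a'] exI[of _ "b' + a"]) (simp add: t add_ac)
  next
    case False
    with t show ?thesis by (intro exI[of _ a] exI[of _ b]) (simp add: add_ac)
  qed
qed

text \<open>Here \<open>e\<close> is the exponent of \<open>h\<close>, the zeros in the cap of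
  \<open>U\<close> say that the generators of \<open>I\<close> avoid the variables of
  \<open>h\<close>, and the last hypothesis is the description of the powers of
  \<open>I \<inter> q\<close>.\<close>

lemma nfold_Int_deg_ge_subset:
  fixes U :: "('n::finite \<Rightarrow>\<^sub>0 nat) set"
  assumes U: "capped (\<lambda>i. if Poly_Mapping.lookup e i = 0 then 1 else 0) U"
    and e: "\<And>i. Poly_Mapping.lookup e i \<le> 1" "Poly_Mapping.keys e \<inter> S = {}"
    and J: "\<And>k. nfold U k \<inter> deg_ge S k \<subseteq> nfold (U \<inter> deg_ge S 1) k"
  shows "nfold U k \<inter> (\<Inter>r\<in>Poly_Mapping.keys e. deg_ge (insert r S) k)
    \<subseteq> nfold (U \<inter> (deg_ge S 1 \<union> {t. \<exists>r. t = e + r})) k" (is "_ \<subseteq> nfold ?L k")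
proof
  fix t
  assume t: "t \<in> nfold U k \<inter> (\<Inter>r\<in>Poly_Mapping.keys e. deg_ge (insert r S) k)"
  have deg: "k \<le> Poly_Mapping.lookup t r + (\<Sum>i\<in>S. Poly_Mapping.lookup t i)" if r: "r \<in> Poly_Mapping.keys e" for r
  proof -
    have "t \<in> deg_ge (insert r S) k" using t r by blast
    moreover have "r \<notin> S" using e(2) r by blast
    ultimately show ?thesis by (simp add: deg_ge_def)
  qed
  from t have "t \<in> nfold U k" by blast
  then show "t \<in> nfold ?L k"
    using deg
  proof (induction k arbitrary: t)
    case (Suc k)
    show ?case
    proof (cases "t \<in> deg_ge S (Suc k)")
      case True
      with J Suc.prems have "t \<in> nfold (U \<inter> deg_ge S 1) (Suc k)" by blast
      also have "\<dots> \<subseteq> nfold ?L (Suc k)" by (rule nfold_mono) blast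
      finally show ?thesis .
    next
      case False
      obtain a b where t: "t = a + b" and a: "a \<in> U" "a \<notin> deg_ge S 1" and b: "b \<in> nfold U k"
        using nfold_split_degree_0[OF upset_capped[OF U] Suc.prems(1) False] by blast
      \<comment> \<open>The factor \<open>a\<close> is adjusted to exponent 1 in each variable of
        \<open>h\<close>. It stays in \<open>U\<close>, whose cap vanishes there, and becomes a
        multiple of \<open>e\<close>; surplus powers of these variables stay in
        \<open>t - a'\<close>.\<close>
      define a' where "a' = Poly_Mapping.Abs_poly_mapping
        (\<lambda>i. if Poly_Mapping.lookup e i = 0 then Poly_Mapping.lookup a i else 1)"
      have a': "Poly_Mapping.lookup a' i = (if Poly_Mapping.lookup e i = 0 then Poly_Mapping.lookup a i else 1)" for i
        by (simp add: a'_def)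
      have a'S: "Poly_Mapping.lookup a' i = 0" if "i \<in> S" for i
      proof -
        have "Poly_Mapping.lookup e i = 0" using e(2) that by (auto simp: in_keys_iff)
        moreover have "Poly_Mapping.lookup a i = 0" using a(2) that unfolding deg_ge_1_iff by blast
        ultimately show ?thesis by (simp add: a')
      qed
      \<comment> \<open>The degree of \<open>t\<close> in \<open>S\<close> is below
        \<open>Suc k\<close>, so the inequality for \<open>r\<close> forces \<open>r\<close> to
        occur in \<open>t\<close>.\<close>
      have pos: "0 < Poly_Mapping.lookup t r" if "r \<in> Poly_Mapping.keys e" for r
        using Suc.prems(2)[OF that] False by (simp add: deg_ge_def)
      have t_eq: "t = (t - a') + a'"
      proof (rule poly_mapping_eqI)
        show "Poly_Mapping.lookup t i = Poly_Mapping.lookup (t - a' + a') i" for i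
          using pos[of i] by (cases "i \<in> Poly_Mapping.keys e") (auto simp: a' lookup_add lookup_minus t in_keys_iff)
      qed
      have "a' \<in> U" using U a(1) by (rule cappedD) (simp add: a')
      moreover have "a' = e + (a' - e)"
        by (intro poly_mapping_eqI) (use e(1) in \<open>simp add: lookup_add lookup_minus a'\<close>)
      ultimately have "a' \<in> ?L" by blast
      moreover have "t - a' \<in> nfold ?L k"
      proof (rule Suc.IH)
        show "t - a' \<in> nfold U k"
          using capped_nfold[OF U] b by (rule cappedD) (simp add: lookup_minus t lookup_add a')
        fix r assume r: "r \<in> Poly_Mapping.keys e"
        \<comment> \<open>Removing \<open>a'\<close> keeps the degree in \<open>S\<close> and lowers
          the exponent of \<open>r\<close> by one, so the inequality passes to
          \<open>k\<close>.\<close>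
        have "(\<Sum>i\<in>S. Poly_Mapping.lookup (t - a') i) = (\<Sum>i\<in>S. Poly_Mapping.lookup t i)"
          by (rule sum.cong) (simp_all add: lookup_minus a'S)
        then show "k \<le> Poly_Mapping.lookup (t - a') r + (\<Sum>i\<in>S. Poly_Mapping.lookup (t - a') i)"
          using Suc.prems(2)[OF r] r by (simp add: lookup_minus a' in_keys_iff)
      qed
      ultimately show ?thesis by (subst t_eq) (auto simp: set_plus_def)
    qed
  qed simp
qed

text \<open>Torsion-freeness enters through \<open>ass\<close>. A missing monomial yields an
  associated prime of the power that contains both \<open>Q\<close> and the ideal of
  \<open>U\<close>; the first inclusion forces it to be \<open>Q\<close>, and then the second is
  impossible.\<close>

lemma nfold_Int_deg_ge_subset_Ass:
  fixes U :: "('n::finite \<Rightarrow>\<^sub>0 nat) set" and S :: "'n set"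
  defines "Q \<equiv> exp_ideal (deg_ge S 1) :: ('n, 'a::field) mpoly set"
  assumes U: "capped (\<lambda>_. 1) U"
    and ass: "Ass mpoly_ring (exp_ideal (nfold (U \<inter> deg_ge S 1) k)) \<subseteq> Ass mpoly_ring (exp_ideal U) \<union> {Q}"
    and incomparable: "\<And>P. P \<in> Ass mpoly_ring (exp_ideal U) \<Longrightarrow> \<not> P \<subseteq> Q \<and> \<not> Q \<subseteq> P"
  shows "nfold U k \<inter> deg_ge S k \<subseteq> nfold (U \<inter> deg_ge S 1) k"
proof
  fix t assume t: "t \<in> nfold U k \<inter> deg_ge S k"
  let ?J = "U \<inter> deg_ge S 1"
  have upU: "upset U" and cJ: "capped (\<lambda>_. 1) ?J"
    using U capped_deg_ge_1 by (auto intro: upset_capped capped_Int)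
  have U_not_sub: "\<not> U \<subseteq> deg_ge S 1"
  proof
    assume sub: "U \<subseteq> deg_ge S 1"
    \<comment> \<open>The product of all variables outside \<open>S\<close> is not in
      \<open>U\<close>. The prime found above it can only use variables absent from
      \<open>w\<close>, hence lies inside \<open>Q\<close>.\<close>
    define w where "w = Poly_Mapping.Abs_poly_mapping (\<lambda>i. if i \<in> S then 0 else 1 :: nat)"
    have w: "Poly_Mapping.lookup w i = (if i \<in> S then 0 else 1)" for i by (simp add: w_def)
    then have "w \<notin> U" using sub by (auto simp: deg_ge_def)
    then obtain r V where rV: "{s. s + (w + r) \<in> U} = deg_ge V 1"
      "\<And>i. i \<in> V \<Longrightarrow> Poly_Mapping.lookup w i < 1"
      using ex_variables_colon[OF U] by metis
    have "V \<subseteq> S"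
    proof
      show "i \<in> S" if "i \<in> V" for i
        using rV(2)[OF that] w[of i] by (cases "i \<in> S") auto
    qed
    then have "deg_ge V 1 \<subseteq> deg_ge S 1"
      unfolding subset_iff deg_ge_1_iff by blast
    then have "exp_ideal (deg_ge V 1) \<subseteq> Q" unfolding Q_def by (rule exp_ideal_mono)
    with incomparable[OF colon_variables_in_Ass[OF upU rV(1)]] show False by blast
  qed
  show "t \<in> nfold ?J k"
  proof (rule ccontr)
    assume "t \<notin> nfold ?J k"
    then obtain r V where r: "{s. s + (t + r) \<in> nfold ?J k} = deg_ge V 1"
      using ex_variables_colon[OF capped_nfold[OF cJ]] by metis
    let ?P = "exp_ideal (deg_ge V 1) :: ('n, 'a) mpoly set"
    have P: "?P \<in> Ass mpoly_ring (exp_ideal (nfold ?J k))"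
      by (rule colon_variables_in_Ass[OF upset_nfold[OF upset_capped[OF cJ]] r])
    \<comment> \<open>If the prime contains the \<open>k\<close>-th power of a monomial, it contains
      the monomial.\<close>
    have sum_mem: "s \<in> deg_ge V 1" if "(\<Sum>j<k. s) + (t + r) \<in> nfold ?J k" for s
    proof -
      from that r have "(\<Sum>j<k. s) \<in> deg_ge V 1" by blast
      then show ?thesis unfolding deg_ge_1_iff by (auto simp: lookup_sum)
    qed
    have "Q \<subseteq> ?P"
      unfolding Q_def
    proof (intro exp_ideal_mono subsetI)
      fix s assume "s \<in> deg_ge S 1"
      moreover have "t + r \<in> nfold U k" using t upU by (auto intro: upsetD upset_nfold)
      ultimately show "s \<in> deg_ge V 1"
        using nfold_add_multiple[OF upU upset_deg_ge] by (intro sum_mem) (simp add: add.commute)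
    qed
    with P ass incomparable have "?P = Q" by blast
    then have V: "deg_ge V 1 = deg_ge S 1" by (simp add: Q_def exp_ideal_eq_iff)
    have "U \<subseteq> deg_ge S 1"
    proof
      fix s assume "s \<in> U"
      moreover have "t + r \<in> nfold (deg_ge S 1) k"
        unfolding nfold_deg_ge using t upsetD[OF upset_deg_ge] by blast
      ultimately have "s \<in> deg_ge V 1"
        using nfold_add_multiple[OF upset_deg_ge upU]
        by (intro sum_mem) (simp add: add.commute Int_commute)
      with V show "s \<in> deg_ge S 1" by simp
    qed
    with U_not_sub show False ..
  qed
qed

section \<open>Translation of the given ideals and supports into exponents\<close>

lemma single_1_eq_iff:
  "Poly_Mapping.single s (1::'a::zero_neq_one) = Poly_Mapping.single t 1 \<longleftrightarrow> s = t"
  by (metis lookup_single_eq lookup_single_not_eq zero_neq_one)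

lemma genideal_Var:
  fixes S :: "'n::finite set"
  shows "Idl\<^bsub>mpoly_ring\<^esub> (Var ` S) = (exp_ideal (deg_ge S 1) :: ('n, 'a::field) mpoly set)"
proof -
  have "{t. \<exists>s r. Poly_Mapping.single s 1 \<in> (Var ` S :: ('n, 'a) mpoly set) \<and> t = s + r} = deg_ge S 1"
  proof (intro equalityI subsetI)
    fix t assume "t \<in> {t. \<exists>s r. Poly_Mapping.single s 1 \<in> (Var ` S :: ('n, 'a) mpoly set) \<and> t = s + r}"
    then obtain i r where "i \<in> S" "t = Poly_Mapping.single i 1 + r"
      by (auto simp: Var_def single_1_eq_iff)
    then show "t \<in> deg_ge S 1"
      unfolding deg_ge_1_iff by (auto simp: lookup_add intro!: bexI[of _ i])
  next
    fix t assume "t \<in> deg_ge S 1"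
    then obtain i where i: "i \<in> S" "Poly_Mapping.lookup t i \<noteq> 0" unfolding deg_ge_1_iff by blast
    have "t = Poly_Mapping.single i 1 + (t - Poly_Mapping.single i 1)"
      using i(2) by (intro poly_mapping_eqI) (auto simp: lookup_add lookup_minus lookup_single when_def)
    moreover have "Poly_Mapping.single (Poly_Mapping.single i 1) 1 \<in> (Var ` S :: ('n, 'a) mpoly set)"
      using i(1) by (simp add: Var_def)
    ultimately show "t \<in> {t. \<exists>s r. Poly_Mapping.single s 1 \<in> (Var ` S :: ('n, 'a) mpoly set) \<and> t = s + r}"
      by blast
  qed
  moreover have "(Var ` S :: ('n, 'a) mpoly set) \<subseteq> monomials"
    by (auto simp: Var_def monomials_def)
  ultimately show ?thesis by (simp add: genideal_monomials)
qed

lemma cgenideal_single: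
  "PIdl\<^bsub>mpoly_ring\<^esub> (Poly_Mapping.single e 1) = (exp_ideal {t. \<exists>r. t = e + r} :: ('n, 'a::field) mpoly set)"
proof -
  have "PIdl\<^bsub>mpoly_ring\<^esub> (Poly_Mapping.single e 1)
      = (Idl\<^bsub>mpoly_ring\<^esub> {Poly_Mapping.single e 1} :: ('n, 'a) mpoly set)"
    by (rule cring.cgenideal_eq_genideal[OF cring_mpoly_ring]) simp
  also have "\<dots> = exp_ideal {t. \<exists>s r. Poly_Mapping.single s 1 \<in> {Poly_Mapping.single e (1::'a)} \<and> t = s + r}"
    by (rule genideal_monomials) (auto simp: monomials_def)
  also have "{t. \<exists>s r. Poly_Mapping.single s 1 \<in> {Poly_Mapping.single e (1::'a)} \<and> t = s + r} = {t. \<exists>r. t = e + r}"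
    by (auto simp: single_1_eq_iff)
  finally show ?thesis .
qed

text \<open>A squarefree generator dividing \<open>t\<close> already divides the truncation of
  \<open>t\<close> at 1.\<close>

lemma squarefree_monomial_ideal_exp_ideal:
  fixes I :: "('n, 'a::field) mpoly set"
  assumes "squarefree_monomial_ideal I"
  obtains U where "I = exp_ideal U" "capped (\<lambda>_. 1) U"
proof -
  obtain G where G: "G \<subseteq> squarefree_monomials" and I: "I = Idl\<^bsub>mpoly_ring\<^esub> G"
    using assms by (auto simp: squarefree_monomial_ideal_def)
  let ?U = "{t. \<exists>s r. Poly_Mapping.single s 1 \<in> G \<and> t = s + r}"
  have "I = exp_ideal ?U"
    unfolding I using G by (intro genideal_monomials) (auto simp: squarefree_monomials_def)
  moreover have "capped (\<lambda>_. 1) ?U"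
    unfolding capped_def
  proof (intro ballI allI impI)
    fix t s assume t: "t \<in> ?U" and le: "\<forall>i. min 1 (Poly_Mapping.lookup t i) \<le> Poly_Mapping.lookup s i"
    from t obtain g r where g: "Poly_Mapping.single g 1 \<in> G" "t = g + r" by blast
    from g(1) have "Poly_Mapping.single g (1::'a) \<in> squarefree_monomials" using G by blast
    then have sf: "Poly_Mapping.lookup g i \<le> 1" for i by (simp only: squarefree_monomials_iff)
    have "s = g + (s - g)"
    proof (rule poly_mapping_eqI)
      fix i
      have "Poly_Mapping.lookup g i \<le> Poly_Mapping.lookup s i"
        using le[rule_format, of i] sf[of i] unfolding g(2) lookup_add by linarith
      then show "Poly_Mapping.lookup s i = Poly_Mapping.lookup (g + (s - g)) i"
        by (simp add: lookup_add lookup_minus)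
    qed
    with g(1) show "s \<in> ?U" by blast
  qed
  ultimately show ?thesis by (rule that)
qed

text \<open>The divisor \<open>s\<close> is the exponent of a minimal generator. This turns
  hypotheses on \<open>ideal_supp\<close> into statements about exponents.\<close>

lemma exp_ideal_supp_cases:
  fixes I :: "('n::finite, 'a::field) mpoly set"
  assumes G: "G \<subseteq> monomials" "I = Idl\<^bsub>mpoly_ring\<^esub> G" and I: "I = exp_ideal U" and t: "t \<in> U"
  obtains s r where "s \<in> U" "t = s + r" "Poly_Mapping.keys s \<subseteq> ideal_supp I"
proof -
  let ?M = "minimal_generators I"
  have M: "?M \<subseteq> monomials \<and> Idl\<^bsub>mpoly_ring\<^esub> ?M = I \<and> (\<forall>H'. H' \<subset> ?M \<longrightarrow> Idl\<^bsub>mpoly_ring\<^esub> H' \<noteq> I)"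
    unfolding minimal_generators_def by (rule theI'[OF minimal_generators_eq(2)[OF G]])
  have "Poly_Mapping.single t 1 \<in> I" using t by (simp add: I mem_exp_ideal_single)
  with M have "\<exists>g\<in>?M. g dvd Poly_Mapping.single t 1"
    by (intro monomial_in_genideal) (auto simp: monomials_def)
  then obtain g where g: "g \<in> ?M" "g dvd Poly_Mapping.single t 1" ..
  with M obtain s where s: "g = Poly_Mapping.single s 1" by (auto simp: monomials_def)
  obtain r where "t = s + r" using g(2) unfolding s monomial_dvd_iff by blast
  moreover have "Poly_Mapping.keys s \<subseteq> ideal_supp I"
    using g(1) supp_monomial[of s] unfolding ideal_supp_def s by blast
  moreover have "g \<in> I"
    using minimal_generators_eq(1)[OF G] g(1) by blast
  then have "s \<in> U" by (simp add: s I mem_exp_ideal_single)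
  ultimately show ?thesis using that by blast
qed

section \<open>Associated primes of the powers of \<open>L\<close>\<close>

lemma Ass_exp_ideal_Int_INT:
  fixes U :: "('n::finite \<Rightarrow>\<^sub>0 nat) set"
  assumes U: "upset U" and "finite H"
  shows "Ass mpoly_ring (exp_ideal (U \<inter> (\<Inter>r\<in>H. deg_ge (insert r S) k)) :: ('n, 'a::field) mpoly set)
    \<subseteq> Ass mpoly_ring (exp_ideal U) \<union> (\<lambda>r. exp_ideal (deg_ge (insert r S) 1)) ` H"
  using assms(2)
proof (induction H)
  case (insert x H)
  let ?W = "U \<inter> (\<Inter>r\<in>H. deg_ge (insert r S) k)"
  have W: "upset ?W"
    using U upset_deg_ge by (fastforce simp: upset_def)
  have "exp_ideal (U \<inter> (\<Inter>r\<in>insert x H. deg_ge (insert r S) k))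
      = exp_ideal ?W \<inter> (exp_ideal (deg_ge (insert x S) k) :: ('n, 'a) mpoly set)"
    by (auto simp: exp_ideal_def)
  moreover have "Ass mpoly_ring (exp_ideal ?W \<inter> exp_ideal (deg_ge (insert x S) k))
      \<subseteq> Ass mpoly_ring (exp_ideal ?W) \<union> Ass mpoly_ring (exp_ideal (deg_ge (insert x S) k) :: ('n, 'a) mpoly set)"
    using W upset_deg_ge by (intro Ass_Int_subset cring_mpoly_ring ideal_exp_ideal)
  ultimately show ?case
    using insert.IH Ass_deg_ge[of "insert x S" k] by auto
qed simp

theorem lemma2p5:
  fixes I q :: "('n::finite, 'a::field) mpoly set" and h :: "('n, 'a) mpoly"
  assumes "squarefree_monomial_ideal I"
    and "prime_monomial_ideal q"
    and "h \<in> squarefree_monomials"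
    and "supp h \<inter> (ideal_supp q \<union> ideal_supp I) = {}"
    and "minimal_primary_decomposition mpoly_ring
           (Inl ` Ass mpoly_ring I \<union> Inr ` supp h)
           (case_sum (\<lambda>p. p) (\<lambda>r. q <+>\<^bsub>mpoly_ring\<^esub> PIdl\<^bsub>mpoly_ring\<^esub> (Var r)))
           (I \<inter> (q <+>\<^bsub>mpoly_ring\<^esub> PIdl\<^bsub>mpoly_ring\<^esub> h))"
    and "minimal_primary_decomposition mpoly_ring
           (Inl ` Ass mpoly_ring I \<union> {Inr ()})
           (case_sum (\<lambda>p. p) (\<lambda>_. q))
           (I \<inter> q)"
    and "normally_torsion_free mpoly_ring I"
    and "normally_torsion_free mpoly_ring (I \<inter> q)"
  shows "normally_torsion_free mpoly_ring (I \<inter> (q <+>\<^bsub>mpoly_ring\<^esub> PIdl\<^bsub>mpoly_ring\<^esub> h))"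
proof -
  obtain U where I: "I = exp_ideal U" and U: "capped (\<lambda>_. 1) U"
    using squarefree_monomial_ideal_exp_ideal[OF assms(1)] .
  obtain G where G: "G \<subseteq> monomials" "I = Idl\<^bsub>mpoly_ring\<^esub> G"
    using assms(1) by (auto simp: squarefree_monomial_ideal_def squarefree_monomials_def)
  obtain S where qS: "q = Idl\<^bsub>mpoly_ring\<^esub> (Var ` S)"
    using assms(2) by (auto simp: prime_monomial_ideal_def)
  then have q: "q = exp_ideal (deg_ge S 1)" by (simp only: genideal_Var)
  have VarS: "(Var ` S :: ('n, 'a) mpoly set) \<subseteq> monomials" by (auto simp: Var_def monomials_def)
  from assms(3) obtain e where h: "h = Poly_Mapping.single e 1"
    by (auto simp: squarefree_monomials_def monomials_def)
  have e_le: "Poly_Mapping.lookup e i \<le> 1" for i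
    using assms(3) by (simp only: h squarefree_monomials_iff)
  let ?H = "Poly_Mapping.keys e"
  have supp_h: "supp h = ?H" by (simp add: h supp_monomial)
  let ?J = "U \<inter> deg_ge S 1"
  let ?L = "U \<inter> (deg_ge S 1 \<union> {t. \<exists>r. t = e + r})"
  have upU: "upset U" using U by (rule upset_capped)
  have up_e: "upset {t. \<exists>r. t = e + r}" by (auto simp: upset_def add.assoc)
  have upL: "upset ?L" by (intro upset_Int upset_Un upU upset_deg_ge up_e)
  have upJ: "upset ?J" by (intro upset_Int upU upset_deg_ge)
  have J_eq: "I \<inter> q = exp_ideal ?J" by (simp add: I q exp_ideal_Int)
  have L_eq: "I \<inter> (q <+>\<^bsub>mpoly_ring\<^esub> PIdl\<^bsub>mpoly_ring\<^esub> h) = exp_ideal ?L"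
    unfolding I q h cgenideal_single set_add_exp_ideal[OF upset_deg_ge up_e] by (simp add: exp_ideal_Int)
  have qr_eq: "q <+>\<^bsub>mpoly_ring\<^esub> PIdl\<^bsub>mpoly_ring\<^esub> (Var r) = exp_ideal (deg_ge (insert r S) 1)" for r
  proof -
    have "PIdl\<^bsub>mpoly_ring\<^esub> (Var r) = (Idl\<^bsub>mpoly_ring\<^esub> (Var ` {r}) :: ('n, 'a) mpoly set)"
      using cring.cgenideal_eq_genideal[OF cring_mpoly_ring, of "Var r"] by simp
    then have "q <+>\<^bsub>mpoly_ring\<^esub> PIdl\<^bsub>mpoly_ring\<^esub> (Var r) = exp_ideal (deg_ge S 1 \<union> deg_ge {r} 1)"
      unfolding q genideal_Var by (simp add: set_add_exp_ideal upset_deg_ge)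
    also have "deg_ge S 1 \<union> deg_ge {r} 1 = deg_ge (insert r S) 1"
      unfolding set_eq_iff Un_iff deg_ge_1_iff by blast
    finally show ?thesis .
  qed
  \<comment> \<open>For \<open>i\<close> in \<open>S\<close>, the minimal generator of
    \<open>q\<close> dividing the variable \<open>i\<close> is that variable, so \<open>i\<close>
    lies in \<open>ideal_supp q\<close>.\<close>
  have disjoint: "?H \<inter> S = {}"
  proof (rule ccontr)
    assume "?H \<inter> S \<noteq> {}"
    then obtain i where i: "i \<in> ?H" "i \<in> S" by blast
    have "Poly_Mapping.single i 1 \<in> deg_ge S 1"
      using i(2) unfolding deg_ge_1_iff by (intro bexI[of _ i]) simp_all
    then obtain s r where s: "s \<in> deg_ge S 1" "Poly_Mapping.single i 1 = s + r" "Poly_Mapping.keys s \<subseteq> ideal_supp q"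
      using exp_ideal_supp_cases[OF VarS qS q] by blast
    obtain j where j: "Poly_Mapping.lookup s j \<noteq> 0" using s(1) unfolding deg_ge_1_iff by blast
    moreover have "Poly_Mapping.lookup (Poly_Mapping.single i (1::nat)) j = Poly_Mapping.lookup s j + Poly_Mapping.lookup r j"
      unfolding s(2) by (rule lookup_add)
    ultimately have "j = i" by (auto simp: lookup_single when_def split: if_splits)
    with j have "i \<in> Poly_Mapping.keys s" by (simp add: in_keys_iff)
    with s(3) i(1) assms(4) supp_h show False by blast
  qed
  have U_e: "capped (\<lambda>i. if Poly_Mapping.lookup e i = 0 then 1 else 0) U"
    unfolding capped_def
  proof (intro ballI allI impI)
    fix t s assume t: "t \<in> U"
      and s: "\<forall>i. min (if Poly_Mapping.lookup e i = 0 then 1 else 0) (Poly_Mapping.lookup t i) \<le> Poly_Mapping.lookup s i"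
    \<comment> \<open>The minimal generator \<open>g\<close> avoids the variables of
      \<open>h\<close>, so the missing bound on \<open>s\<close> in these variables does no
      harm.\<close>
    obtain g r where g: "g \<in> U" "t = g + r" "Poly_Mapping.keys g \<subseteq> ideal_supp I"
      using exp_ideal_supp_cases[OF G I t] .
    show "s \<in> U"
    proof (rule cappedD[OF U g(1)])
      fix i
      show "min 1 (Poly_Mapping.lookup g i) \<le> Poly_Mapping.lookup s i"
      proof (cases "i \<in> ?H")
        case True
        then have "i \<notin> Poly_Mapping.keys g" using g(3) assms(4) supp_h by blast
        then have "Poly_Mapping.lookup g i = 0" by (simp add: in_keys_iff)
        then show ?thesis by simp
      next
        case False
        then show ?thesis using s[rule_format, of i] by (auto simp: in_keys_iff g(2) lookup_add)
      qed
    qed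
  qed
  have incomparable: "\<not> P \<subseteq> q \<and> \<not> q \<subseteq> P" if "P \<in> Ass mpoly_ring I" for P
    using primary_components_incomparable[OF assms(6), of "Inl P" "Inr ()"]
      primary_components_incomparable[OF assms(6), of "Inr ()" "Inl P"] that by auto
  have Ass_J: "Ass mpoly_ring (exp_ideal ?J) \<subseteq> Ass mpoly_ring I \<union> {q}"
  proof -
    have "Ass mpoly_ring q \<subseteq> {q}" unfolding q by (rule Ass_deg_ge)
    moreover have "Ass mpoly_ring (I \<inter> q) \<subseteq> Ass mpoly_ring I \<union> Ass mpoly_ring q"
      unfolding I q by (intro Ass_Int_subset cring_mpoly_ring ideal_exp_ideal upU upset_deg_ge)
    ultimately show ?thesis unfolding J_eq by blast
  qed
  have J_symbolic: "nfold U k \<inter> deg_ge S k \<subseteq> nfold ?J k" for k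
  proof (cases k)
    \<comment> \<open>Torsion-freeness concerns positive powers; for \<open>k = 0\<close> both sides
      are \<open>UNIV\<close>.\<close>
    case (Suc k')
    have "Ass mpoly_ring (exp_ideal (nfold ?J k)) \<subseteq> Ass mpoly_ring (exp_ideal ?J :: ('n, 'a) mpoly set)"
      using assms(8) Suc unfolding J_eq normally_torsion_free_def
      by (metis ideal_power_exp_ideal[OF upJ] le_add1 plus_1_eq_Suc)
    also note Ass_J
    finally show ?thesis
      using incomparable unfolding I q by (intro nfold_Int_deg_ge_subset_Ass[OF U])
  qed simp
  have L_nfold: "nfold ?L k = nfold U k \<inter> (\<Inter>r\<in>?H. deg_ge (insert r S) k)" for k
  proof
    \<comment> \<open>Each \<open>r\<close> in the support of \<open>h\<close> divides
      \<open>h\<close>, so \<open>L\<close> lies in every \<open>(q, x_r)\<close>.\<close>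
    have "?L \<subseteq> deg_ge (insert r S) 1" if r: "r \<in> ?H" for r
      unfolding subset_iff Int_iff Un_iff deg_ge_1_iff using r
      by (auto simp: lookup_add in_keys_iff)
    then have "nfold ?L k \<subseteq> deg_ge (insert r S) k" if "r \<in> ?H" for r
      using nfold_mono[of ?L "deg_ge (insert r S) 1" k] that unfolding nfold_deg_ge by blast
    moreover have "nfold ?L k \<subseteq> nfold U k" by (rule nfold_mono) blast
    ultimately show "nfold ?L k \<subseteq> nfold U k \<inter> (\<Inter>r\<in>?H. deg_ge (insert r S) k)" by blast
    show "nfold U k \<inter> (\<Inter>r\<in>?H. deg_ge (insert r S) k) \<subseteq> nfold ?L k"
      using nfold_Int_deg_ge_subset[OF U_e e_le disjoint J_symbolic] .
  qed
  have components: "Ass mpoly_ring I \<union> (\<lambda>r. exp_ideal (deg_ge (insert r S) 1)) ` ?H \<subseteq> Ass mpoly_ring (exp_ideal ?L)"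
  proof -
    \<comment> \<open>All components of the given decomposition of \<open>L\<close> are prime, hence
      associated to \<open>L\<close>.\<close>
    note in_Ass = primary_component_in_Ass[OF cring_mpoly_ring ideal_exp_ideal[OF upL] assms(5)[unfolded L_eq qr_eq supp_h]]
    have "P \<in> Ass mpoly_ring (exp_ideal ?L)" if "P \<in> Ass mpoly_ring I" for P
      using in_Ass[of "Inl P"] that by (auto simp: Ass_def)
    moreover have "(exp_ideal (deg_ge (insert r S) 1) :: ('n, 'a) mpoly set) \<in> Ass mpoly_ring (exp_ideal ?L)" if "r \<in> ?H" for r
      using in_Ass[of "Inr r"] that primeideal_exp_ideal_deg_ge[of "insert r S"] by auto
    ultimately show ?thesis by blast
  qed
  let ?LI = "exp_ideal ?L :: ('n, 'a) mpoly set"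
  show ?thesis
    unfolding L_eq normally_torsion_free_def
  proof (intro conjI allI impI)
    show "ideal ?LI mpoly_ring" by (rule ideal_exp_ideal[OF upL])
    fix k :: nat assume k: "k \<ge> 1"
    have "Ass mpoly_ring (?LI [^]\<^bsub>ideals_set mpoly_ring\<^esub> k)
        = Ass mpoly_ring (exp_ideal (nfold U k \<inter> (\<Inter>r\<in>?H. deg_ge (insert r S) k)) :: ('n, 'a) mpoly set)"
      by (simp only: ideal_power_exp_ideal[OF upL] L_nfold)
    also have "\<dots> \<subseteq> Ass mpoly_ring (exp_ideal (nfold U k)) \<union> (\<lambda>r. exp_ideal (deg_ge (insert r S) 1)) ` ?H"
      by (intro Ass_exp_ideal_Int_INT upset_nfold upU) simp
    finally have "Ass mpoly_ring (?LI [^]\<^bsub>ideals_set mpoly_ring\<^esub> k)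
        \<subseteq> Ass mpoly_ring (exp_ideal (nfold U k)) \<union> (\<lambda>r. exp_ideal (deg_ge (insert r S) 1)) ` ?H" .
    moreover have "Ass mpoly_ring (exp_ideal (nfold U k)) \<subseteq> Ass mpoly_ring I"
      using assms(7) k unfolding I normally_torsion_free_def by (metis ideal_power_exp_ideal[OF upU])
    ultimately show "Ass mpoly_ring (?LI [^]\<^bsub>ideals_set mpoly_ring\<^esub> k) \<subseteq> Ass mpoly_ring ?LI"
      using components by blast
  qed
qed

end
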